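(* Let $p>1$, let $f$ be a valid feedback function with $f(n)\sim n^p$ as $n\to+\infty$, and let $(x,y)\in\mathbb{N}^2$ be fixed. Let $c>0$ be the constant (depending only on $x$, $y$ and $f$) such that, for the two-bin balls-in-bins process with feedback function $f$, $\mathbf{Pr}_{(x,y)}(L>n)\sim c\sum_{j=n}^{+\infty}\frac{1}{f(j)}$ as $n\to+\infty$ (such a constant exists). Then, as $n\to+\infty$, $$\mathbf{Pr}_{(x,y)}(L>n)\sim\frac{c}{(p-1)\,n^{p-1}}.$$
   Context: $\mathbb{N}=\{1,2,3,\dots\}$; $a_n\sim b_n$ means $a_n/b_n\to 1$. The existence of $c$ is part of what is asserted. Two-bin balls-in-bins process with feedback function $f:\mathbb{N}\to(0,+\infty)$: the discrete-time Markov chain $\{(I_1(m),I_2(m))\}_{m\geq 0}$ on $\mathbb{N}^2$ in which at each time $m\ge 1$ exactly one ball is added, to bin $i_m\in\{1,2\}$ (so $I_{i_m}(m)=I_{i_m}(m-1)+1$ and the other coordinate is unchanged), where, conditionally on the past, $i_m=i$ with probability $f(I_i(m-1))/(f(I_1(m-1))+f(I_2(m-1)))$. $\mathbf{Pr}_{u}$ denotes probability when the initial state $(I_1(0),I_2(0))$ is $u\in\mathbb{N}^2$. When $\sum_j f(j)^{-1}<+\infty$, it is known that almost surely exactly one bin receives all but finitely many of the balls. The other bin is called the losing bin, and the losing number $L$ is the (almost surely finite) final number of balls in the losing bin, i.e. $L=\lim_{m\to\infty} I_i(m)$ for $i$ the losing bin. Valid feedback function: an increasing function $f:\mathbb{N}\to(0,+\infty)$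 with $f(1)=1$ that can be extended to a $C^1$ function $g:[1,+\infty)\to(0,+\infty)$ such that, with $h(x)= x(\ln g)'(x)$ for $x\ge 1$: (1) $\liminf_{x\to+\infty}h(x)>1$; (2) $\lim_{x\to+\infty}x^{-1/4}h(x)=0$; (3) there exist $C>0$ and $x_0\geq 1$ such that for all $\epsilon\in(0,1)$ and all $x\ge x_0$, $\sup_{x\le t\le x^{1+\epsilon}}\left|\frac{h(t)}{h(x)}-1\right|\le C\epsilon$. *)

theory Defs
  imports "HOL-Probability.Probability" "HOL-Library.Landau_Symbols"
begin

datatype bin = Bin1 | Bin2

fun other :: "bin \<Rightarrow> bin" where
  "other Bin1 = Bin2"
| "other Bin2 = Bin1"

text \<open>A state is the pair of ball counts \<open>(I\<^sub>1, I\<^sub>2)\<close>, a trajectory the sequence of states at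
  times \<open>0, 1, 2, \<dots>\<close>.\<close>

type_synonym state = "nat \<times> nat"

fun count_in :: "bin \<Rightarrow> state \<Rightarrow> nat" where
  "count_in Bin1 (a, b) = a"
| "count_in Bin2 (a, b) = b"

fun add_ball :: "bin \<Rightarrow> state \<Rightarrow> state" where
  "add_ball Bin1 (a, b) = (Suc a, b)"
| "add_ball Bin2 (a, b) = (a, Suc b)"

definition choose_bin :: "(nat \<Rightarrow> real) \<Rightarrow> state \<Rightarrow> bin pmf" where
  "choose_bin f s =
     map_pmf (\<lambda>b. if b then Bin1 else Bin2)
       (bernoulli_pmf (f (count_in Bin1 s) / (f (count_in Bin1 s) + f (count_in Bin2 s))))"

definition step :: "(nat \<Rightarrow> real) \<Rightarrow> state \<Rightarrow> state pmf" where
  "step f s = map_pmf (\<lambda>i. add_ball i s) (choose_bin f s)"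

lemma pmf_choose_bin:
  assumes "f (count_in Bin1 s) > 0" "f (count_in Bin2 s) > 0"
  shows "pmf (choose_bin f s) i =
           f (count_in i s) / (f (count_in Bin1 s) + f (count_in Bin2 s))"
proof -
  let ?p = "f (count_in Bin1 s) / (f (count_in Bin1 s) + f (count_in Bin2 s))"
  have p: "0 \<le> ?p" "?p \<le> 1" using assms by auto
  have inj: "inj (\<lambda>b. if b then Bin1 else Bin2)" by (auto simp: inj_def)
  have 1: "pmf (choose_bin f s) Bin1 = ?p"
    using pmf_map_inj'[OF inj, of "bernoulli_pmf ?p" True] p by (simp add: choose_bin_def)
  have "pmf (choose_bin f s) Bin2 = 1 - ?p"
    using pmf_map_inj'[OF inj, of "bernoulli_pmf ?p" False] p by (simp add: choose_bin_def)
  also have "\<dots> = f (count_in Bin2 s) / (f (count_in Bin1 s) + f (count_in Bin2 s))"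
    using assms by (simp add: field_simps)
  finally show ?thesis using 1 by (cases i) auto
qed

text \<open>The law of the state at time \<open>m\<close>, given the states \<open>\<omega> 0, \<dots>, \<omega> (m - 1)\<close>.\<close>

definition step_kernel :: "(nat \<Rightarrow> real) \<Rightarrow> state \<Rightarrow> nat \<Rightarrow> (nat \<Rightarrow> state) \<Rightarrow> state measure" where
  "step_kernel f u m \<omega> = measure_pmf (case m of 0 \<Rightarrow> return_pmf u | Suc k \<Rightarrow> step f (\<omega> k))"

global_interpretation BB: Ionescu_Tulcea "step_kernel f u" "\<lambda>_. count_space UNIV"
  for f u
proof (rule Ionescu_Tulcea.intro)
  fix i :: nat
  show "step_kernel f u i \<in> PiM {0..<i} (\<lambda>_. count_space UNIV) \<rightarrow>\<^sub>M subprob_algebra (count_space UNIV)"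
  proof (cases i)
    case 0
    then show ?thesis
      by (simp add: step_kernel_def[abs_def] measure_pmf_in_subprob_algebra)
  next
    case (Suc k)
    have 1: "(\<lambda>s. measure_pmf (step f s)) \<in> count_space UNIV \<rightarrow>\<^sub>M subprob_algebra (count_space UNIV)"
      by (simp add: measure_pmf_in_subprob_algebra)
    have "(\<lambda>\<omega>. \<omega> k) \<in> PiM {0..<i} (\<lambda>_. count_space (UNIV :: state set)) \<rightarrow>\<^sub>M count_space UNIV"
      using Suc by (intro measurable_component_singleton) auto
    from measurable_compose[OF this 1] Suc show ?thesis
      by (simp add: step_kernel_def[abs_def])
  qed
next
  show "prob_space (step_kernel f u i x)" for i x
    by (simp add: step_kernel_def measure_pmf.prob_space_axioms)
qed

text \<open>The law, on the space of trajectories, of the process with feedback function \<open>f\<close> and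
  initial state \<open>u\<close>: the measure that the Ionescu-Tulcea theorem yields for these kernels.\<close>

definition balls_bins :: "(nat \<Rightarrow> real) \<Rightarrow> state \<Rightarrow> (nat \<Rightarrow> state) measure" where
  "balls_bins f u =
     projective_family.lim UNIV (Ionescu_Tulcea.CI (step_kernel f u) (\<lambda>_. count_space UNIV))
       (\<lambda>_. count_space UNIV)"

lemma sets_balls_bins [measurable_cong]:
  "sets (balls_bins f u) = sets (PiM UNIV (\<lambda>_. count_space UNIV))"
  unfolding balls_bins_def by (rule BB.PF.sets_lim)

lemma space_balls_bins [simp]: "space (balls_bins f u) = UNIV"
  using sets_eq_imp_space_eq[OF sets_balls_bins] by (simp add: space_PiM)

lemma emeasure_balls_bins_prefix:
  "emeasure (balls_bins f u) {\<omega>. \<forall>i<n. \<omega> i = s i} =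
   emeasure (BB.C f u 0 n (\<lambda>_. undefined)) {restrict s {0..<n}}"
proof -
  let ?M = "\<lambda>_::nat. count_space (UNIV :: state set)"
  have S: "{restrict s {0..<n}} \<in> sets (PiM {0..<n} ?M)"
  proof -
    have "{restrict s {0..<n}} = PiE {0..<n} (\<lambda>i. {s i})"
      by (auto simp: PiE_iff extensional_def restrict_def fun_eq_iff)
    also have "\<dots> \<in> sets (PiM {0..<n} ?M)" by (intro sets_PiM_I_finite) auto
    finally show ?thesis .
  qed
  have "{\<omega>. \<forall>i<n. \<omega> i = s i} = prod_emb UNIV ?M {0..<n} {restrict s {0..<n}}"
  proof -
    have "(\<forall>i<n. \<omega> i = s i) \<longleftrightarrow> restrict \<omega> {0..<n} = restrict s {0..<n}" for \<omega>
      by (metis atLeastLessThan_iff le0 restrict_apply' restrict_ext)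
    then show ?thesis by (auto simp: prod_emb_def space_PiM)
  qed
  then have "emeasure (balls_bins f u) {\<omega>. \<forall>i<n. \<omega> i = s i} =
      emeasure (BB.CI f u {0..<n}) {restrict s {0..<n}}"
    unfolding balls_bins_def using S by (simp add: BB.lim)
  also have "\<dots> = emeasure (BB.C f u 0 n (\<lambda>_. undefined))
      (prod_emb {0..<n} ?M {0..<n} {restrict s {0..<n}})"
    using S by (intro BB.emeasure_CI) auto
  also have "prod_emb {0..<n} ?M {0..<n} {restrict s {0..<n}} = {restrict s {0..<n}}"
    using S by (intro prod_emb_id) (auto simp: PiE_iff)
  finally show ?thesis .
qed

lemma prob_space_balls_bins: "prob_space (balls_bins f u)"
proof
  have "emeasure (balls_bins f u) {\<omega>. \<forall>i<0. \<omega> i = undefined i} = 1"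
    unfolding emeasure_balls_bins_prefix by (simp add: restrict_def PiM_empty)
  then show "emeasure (balls_bins f u) (space (balls_bins f u)) = 1" by simp
qed

lemma restrict_Suc_upd_iff: "(restrict s {0..<n})(n := y) = restrict s {0..<Suc n} \<longleftrightarrow> y = s n"
proof
  assume "(restrict s {0..<n})(n := y) = restrict s {0..<Suc n}"
  from fun_cong[OF this, of n] show "y = s n" by simp
next
  assume "y = s n"
  then show "(restrict s {0..<n})(n := y) = restrict s {0..<Suc n}"
    by (intro ext) auto
qed

lemma emeasure_C_Suc:
  "emeasure (BB.C f u 0 (Suc n) (\<lambda>_. undefined)) {restrict s {0..<Suc n}} =
   emeasure (BB.C f u 0 n (\<lambda>_. undefined)) {restrict s {0..<n}} * emeasure (step_kernel f u n s) {s n}"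
proof -
  let ?M = "\<lambda>_::nat. count_space (UNIV :: state set)"
  let ?C = "BB.C f u 0 n (\<lambda>_. undefined)"
  have S: "{restrict s {0..<n}} \<in> sets (PiM {0..<n} ?M)" for n
  proof -
    have "{restrict s {0..<n}} = PiE {0..<n} (\<lambda>i. {s i})"
      by (auto simp: PiE_iff extensional_def restrict_def fun_eq_iff)
    also have "\<dots> \<in> sets (PiM {0..<n} ?M)" by (intro sets_PiM_I_finite) auto
    finally show ?thesis .
  qed
  have u0: "(\<lambda>_. undefined) \<in> space (PiM {0..<0} ?M)" by (simp add: space_PiM)
  have sp: "space ?C = space (PiM {0..<n} ?M)"
    using BB.space_C[OF u0] by simp
  have meas: "BB.eP f u n \<in> ?C \<rightarrow>\<^sub>M subprob_algebra (PiM {0..<Suc n} ?M)"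
    using BB.measurable_eP[of f u n] BB.sets_C[OF u0, of f u n]
    by (simp cong: measurable_cong_sets)
  have ne: "space ?C \<noteq> {}" unfolding sp by (auto simp: space_PiM PiE_eq_empty_iff)
  have "emeasure (BB.C f u 0 (Suc n) (\<lambda>_. undefined)) {restrict s {0..<Suc n}} =
     (\<integral>\<^sup>+x. emeasure (BB.eP f u n x) {restrict s {0..<Suc n}} \<partial>?C)"
    using emeasure_bind[OF ne meas S[of "Suc n"]] by simp
  also have "\<dots> = (\<integral>\<^sup>+x. emeasure (step_kernel f u n s) {s n} * indicator {restrict s {0..<n}} x \<partial>?C)"
  proof (rule nn_integral_cong)
    fix x assume "x \<in> space ?C"
    then have x: "x \<in> space (PiM {0..<n} ?M)" using sp by simp
    have "emeasure (BB.eP f u n x) {restrict s {0..<Suc n}} =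
        emeasure (step_kernel f u n x) ((\<lambda>y. x(n := y)) -` {restrict s {0..<Suc n}})"
      using BB.emeasure_eP[OF x S[of "Suc n"], of f u] by simp
    also have "\<dots> = emeasure (step_kernel f u n s) {s n} * indicator {restrict s {0..<n}} x"
    proof (cases "x = restrict s {0..<n}")
      case True
      then have "x(n := y) = restrict s {0..<Suc n} \<longleftrightarrow> y = s n" for y
        by (metis restrict_Suc_upd_iff)
      then have "(\<lambda>y. x(n := y)) -` {restrict s {0..<Suc n}} = {s n}"
        by auto
      moreover have "step_kernel f u n x = step_kernel f u n s"
        using True by (simp add: step_kernel_def split: nat.split)
      ultimately show ?thesis using True by simp
    next
      case False
      have "(\<lambda>y. x(n := y)) -` {restrict s {0..<Suc n}} = {}"
      proof (rule ccontr)
        assume "\<not> ?thesis"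
        then obtain y where y: "x(n := y) = restrict s {0..<Suc n}" by auto
        have "x i = restrict s {0..<n} i" for i
          using fun_cong[OF y, of i] x
          by (cases "i < n"; cases "i = n") (auto simp: space_PiM PiE_iff extensional_def)
        with False show False by auto
      qed
      with False show ?thesis by simp
    qed
    finally show "emeasure (BB.eP f u n x) {restrict s {0..<Suc n}} =
        emeasure (step_kernel f u n s) {s n} * indicator {restrict s {0..<n}} x" .
  qed
  also have "\<dots> = emeasure (step_kernel f u n s) {s n} * emeasure ?C {restrict s {0..<n}}"
    using S[of n] BB.sets_C[OF u0, of f u n] by (intro nn_integral_cmult_indicator) simp
  finally show ?thesis by (simp add: mult.commute)
qed

text \<open>The next two facts determine \<open>balls_bins f u\<close> and say that it is the law of the Markov chain
  with initial state \<open>u\<close> and transition probabilities \<open>step f\<close>.\<close>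

lemma measure_balls_bins_0: "measure (balls_bins f u) {\<omega>. \<omega> 0 = u} = 1"
proof -
  have "emeasure (BB.C f u 0 0 (\<lambda>_. undefined)) {restrict (\<lambda>_. u) {0..<0}} = 1"
    by (simp add: restrict_def PiM_empty)
  then have "emeasure (balls_bins f u) {\<omega>. \<forall>i<Suc 0. \<omega> i = u} = 1"
    using emeasure_C_Suc[of f u 0 "\<lambda>_. u"] unfolding emeasure_balls_bins_prefix
    by (simp add: step_kernel_def)
  then show ?thesis by (simp add: measure_def)
qed

lemma measure_balls_bins_Suc:
  "measure (balls_bins f u) {\<omega>. \<forall>i\<le>Suc m. \<omega> i = s i} =
   measure (balls_bins f u) {\<omega>. \<forall>i\<le>m. \<omega> i = s i} * pmf (step f (s m)) (s (Suc m))"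
proof -
  have "emeasure (balls_bins f u) {\<omega>. \<forall>i<Suc (Suc m). \<omega> i = s i} =
    emeasure (balls_bins f u) {\<omega>. \<forall>i<Suc m. \<omega> i = s i} * emeasure (measure_pmf (step f (s m))) {s (Suc m)}"
    unfolding emeasure_balls_bins_prefix
    using emeasure_C_Suc[of f u "Suc m" s] by (simp add: step_kernel_def)
  then show ?thesis
    by (simp add: less_Suc_eq_le measure_def enn2real_mult emeasure_pmf_single)
qed

text \<open>The losing bin is the one whose opponent receives all but finitely many of the balls. On
  trajectories where there is no such bin, the two definitions below give some unspecified value; if \<open>\<Sum>j. 1 / f j\<close> converges, these trajectories form a null set.\<close>

definition losing_bin :: "(nat \<Rightarrow> state) \<Rightarrow> bin" where
  "losing_bin \<omega> = (THE i. \<forall>\<^sub>F m in sequentially. \<omega> (Suc m) = add_ball (other i) (\<omega> m))"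

definition losing_number :: "(nat \<Rightarrow> state) \<Rightarrow> nat" where
  "losing_number \<omega> = lim (\<lambda>m. count_in (losing_bin \<omega>) (\<omega> m))"

lemma measurable_losing_number [measurable]:
  "losing_number \<in> balls_bins f u \<rightarrow>\<^sub>M count_space UNIV"
proof -
  let ?N = "balls_bins f u"
  have [measurable]: "(\<lambda>\<omega>. \<omega> m) \<in> ?N \<rightarrow>\<^sub>M count_space UNIV" for m
    unfolding measurable_cong_sets[OF sets_balls_bins refl]
    by (rule measurable_component_singleton) simp
  define W where "W i \<omega> \<longleftrightarrow> (\<forall>\<^sub>F m in sequentially. \<omega> (Suc m) = add_ball (other i) (\<omega> m))"
    for i and \<omega> :: "nat \<Rightarrow> state"
  have [measurable]: "Measurable.pred ?N (W i)" for i
    unfolding W_def[abs_def] eventually_sequentially by measurable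
  define c where "c = (THE i::bin. False)"
  define d where "d = (THE i::bin. True)"
  have lb: "losing_bin \<omega> = (if W Bin1 \<omega> then (if W Bin2 \<omega> then d else Bin1)
      else (if W Bin2 \<omega> then Bin2 else c))" for \<omega>
  proof -
    have "losing_bin \<omega> = (THE i. W i \<omega>)" by (simp add: losing_bin_def W_def)
    also have "(\<lambda>i. W i \<omega>) = (\<lambda>i. case i of Bin1 \<Rightarrow> W Bin1 \<omega> | Bin2 \<Rightarrow> W Bin2 \<omega>)"
      by (auto simp: fun_eq_iff split: bin.split)
    also have "The \<dots> = (if W Bin1 \<omega> then (if W Bin2 \<omega> then d else Bin1)
      else (if W Bin2 \<omega> then Bin2 else c))"
    proof -
      have "(\<lambda>i. case i of Bin1 \<Rightarrow> True | Bin2 \<Rightarrow> True) = (\<lambda>i. True)"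
           "(\<lambda>i. case i of Bin1 \<Rightarrow> False | Bin2 \<Rightarrow> False) = (\<lambda>i. False)"
           "(\<lambda>i. case i of Bin1 \<Rightarrow> True | Bin2 \<Rightarrow> False) = (\<lambda>i. i = Bin1)"
           "(\<lambda>i. case i of Bin1 \<Rightarrow> False | Bin2 \<Rightarrow> True) = (\<lambda>i. i = Bin2)"
        by (auto simp: fun_eq_iff split: bin.split)
      then show ?thesis by (cases "W Bin1 \<omega>"; cases "W Bin2 \<omega>") (simp_all add: c_def d_def)
    qed
    finally show ?thesis .
  qed
  have [measurable]: "losing_bin \<in> ?N \<rightarrow>\<^sub>M count_space UNIV"
    unfolding lb[abs_def] by measurable
  have conv: "X \<longlonglongrightarrow> L \<longleftrightarrow> (\<exists>n. \<forall>m\<ge>n. X m = L)" for X :: "nat \<Rightarrow> nat" and L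
    by (simp add: tendsto_discrete eventually_sequentially)
  define e where "e = (THE L::nat. False)"
  have lim: "lim X = k \<longleftrightarrow> X \<longlonglongrightarrow> k \<or> ((\<forall>L. \<not> X \<longlonglongrightarrow> L) \<and> e = k)" for X :: "nat \<Rightarrow> nat" and k
  proof (cases "\<exists>L. X \<longlonglongrightarrow> L")
    case True then show ?thesis by (metis limI)
  next
    case False
    then have "lim X = e" unfolding lim_def e_def by presburger
    with False show ?thesis by auto
  qed
  have fun_eq: "count_in (losing_bin \<omega>) (\<omega> m) = k \<longleftrightarrow>
      losing_bin \<omega> = Bin1 \<and> fst (\<omega> m) = k \<or> losing_bin \<omega> = Bin2 \<and> snd (\<omega> m) = k" for \<omega> m k
    by (cases "losing_bin \<omega>"; cases "\<omega> m") auto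
  define Q where "Q k \<omega> \<longleftrightarrow> (\<lambda>m. count_in (losing_bin \<omega>) (\<omega> m)) \<longlonglongrightarrow> k" for k \<omega>
  have [measurable]: "Measurable.pred ?N (Q k)" for k
    unfolding Q_def[abs_def] conv fun_eq by measurable
  have "Measurable.pred ?N (\<lambda>\<omega>. losing_number \<omega> = k)" for k
    unfolding losing_number_def lim Q_def[symmetric] by measurable
  then have "losing_number -` {k} \<inter> space ?N \<in> sets ?N" for k
    by (simp add: pred_def vimage_def)
  then show ?thesis
    by (subst measurable_count_space_eq2_countable) auto
qed

text \<open>Here \<open>\<nat> = {1, 2, \<dots>}\<close>, so the value \<open>f 0\<close> is irrelevant. The derivatives at \<open>1\<close> are one-sided,
  and \<open>L\<close> is the derivative of \<open>ln \<circ> g\<close>. The supremum is taken in \<open>ereal\<close>, where it is \<open>\<infinity>\<close> for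
  an unbounded set. Since \<open>h t / 0 = 0\<close>, the last clause can only hold if \<open>h x \<noteq> 0\<close> for all
  \<open>x \<ge> x0\<close>.\<close>

definition valid_feedback :: "(nat \<Rightarrow> real) \<Rightarrow> bool" where
  "valid_feedback f \<longleftrightarrow>
     (\<forall>n\<ge>1. f n > 0) \<and> mono_on {1..} f \<and> f 1 = 1 \<and>
     (\<exists>g g' L h :: real \<Rightarrow> real.
        (\<forall>n\<ge>1. g (real n) = f n) \<and>
        (\<forall>x\<ge>1. g x > 0) \<and>
        (\<forall>x\<ge>1. (g has_real_derivative g' x) (at x within {1..})) \<and>
        continuous_on {1..} g' \<and>
        (\<forall>x\<ge>1. ((\<lambda>t. ln (g t)) has_real_derivative L x) (at x within {1..})) \<and>
        (\<forall>x\<ge>1. h x = x * L x) \<and>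
        Liminf at_top (\<lambda>x. ereal (h x)) > 1 \<and>
        ((\<lambda>x. x powr (-1/4) * h x) \<longlongrightarrow> 0) at_top \<and>
        (\<exists>C>0. \<exists>x0\<ge>1. \<forall>\<epsilon>\<in>{0<..<1}. \<forall>x\<ge>x0.
           (SUP t\<in>{x..x powr (1 + \<epsilon>)}. ereal \<bar>h t / h x - 1\<bar>) \<le> ereal (C * \<epsilon>)))"

end

theory Submission
  imports Defs "HOL-Real_Asymp.Real_Asymp"
begin

text \<open>Let \<open>G a b\<close> be the probability that the process visits \<open>(a, b)\<close>, and let
  \<open>K a b = f a * f b / (f a + f b) * G a b\<close>. The Kolmogorov equation for \<open>G\<close> becomes
  \<open>(f a + f b) * K a b = f a * K (a - 1) b + f b * K a (b - 1)\<close>, that is, \<open>K\<close> is harmonic for the walk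
  that runs backwards and decreases a coordinate with probability proportional to its \<open>f\<close>-value. The
  function \<open>f a * (K a b - K (a - 1) b) = f b * (K a (b - 1) - K a b)\<close> is harmonic as well, hence
  bounded by its boundary values. As \<open>\<Sum>j. 1 / f j\<close> converges, \<open>K a b\<close> has a limit \<open>l\<close> as
  \<open>a, b \<rightarrow> \<infinity>\<close>, and a second moment estimate for the backward walk gives \<open>l > 0\<close>. The probability
  that both bins exceed \<open>n\<close> is \<open>\<Sum>k>n. (K n k + K k n) / f k\<close>, which is asymptotic to
  \<open>2 * l * (\<Sum>k>n. 1 / f k)\<close>. It tends to \<open>0\<close>, so almost surely one bin stays bounded, and
  then \<open>L > n\<close> means that both bins exceed \<open>n\<close>.\<close>

subsection \<open>Backward harmonic functions\<close>

text \<open>The mean value property of the backward walk, multiplied out to avoid division. It is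
  imposed only above \<open>a0\<close> and \<open>b0\<close>, so the lines \<open>a = a0\<close> and
  \<open>b = b0\<close> act as boundary.\<close>

definition backward_harmonic :: "(nat \<Rightarrow> real) \<Rightarrow> nat \<Rightarrow> nat \<Rightarrow> (nat \<Rightarrow> nat \<Rightarrow> real) \<Rightarrow> bool" where
  "backward_harmonic f a0 b0 h \<longleftrightarrow>
     (\<forall>a\<ge>a0. \<forall>b\<ge>b0. (f (Suc a) + f (Suc b)) * h (Suc a) (Suc b) =
        f (Suc a) * h a (Suc b) + f (Suc b) * h (Suc a) b)"

lemma backward_harmonic_diff:
  "backward_harmonic f a0 b0 h \<Longrightarrow> backward_harmonic f a0 b0 k \<Longrightarrow>
     backward_harmonic f a0 b0 (\<lambda>a b. h a b - k a b)"
  unfolding backward_harmonic_def by (simp add: algebra_simps)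

lemma backward_harmonic_affine:
  "backward_harmonic f a0 b0 h \<Longrightarrow> backward_harmonic f a0 b0 (\<lambda>a b. c + d * h a b)"
  unfolding backward_harmonic_def 
proof (intro allI impI, goal_cases)
  case (1 a b)
  then have "(f (Suc a) + f (Suc b)) * h (Suc a) (Suc b) =
        f (Suc a) * h a (Suc b) + f (Suc b) * h (Suc a) b" by blast
  then have "d * ((f (Suc a) + f (Suc b)) * h (Suc a) (Suc b)) =
        d * (f (Suc a) * h a (Suc b) + f (Suc b) * h (Suc a) b)" by simp
  then show ?case by (simp add: algebra_simps)
qed

lemma backward_harmonic_mono:
  "backward_harmonic f a0 b0 h \<Longrightarrow> a0 \<le> a1 \<Longrightarrow> b0 \<le> b1 \<Longrightarrow> backward_harmonic f a1 b1 h"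
  unfolding backward_harmonic_def by (meson order.trans)

text \<open>Minimum principle: an interior value is a convex combination of its left and lower
  neighbours, and descending along them reaches the boundary in finitely many steps, so a nested
  induction suffices.\<close>

lemma backward_harmonic_nonneg:
  assumes pos: "\<And>n. n \<ge> 1 \<Longrightarrow> f n > 0" and har: "backward_harmonic f a0 b0 h"
    and left: "\<And>b. b \<ge> b0 \<Longrightarrow> h a0 b \<ge> 0" and bottom: "\<And>a. a \<ge> a0 \<Longrightarrow> h a b0 \<ge> 0"
    and "a \<ge> a0" "b \<ge> b0"
  shows "h a b \<ge> 0"
proof -
  have "\<forall>b\<ge>b0. h a b \<ge> 0" using \<open>a \<ge> a0\<close>
  proof (induction a rule: nat_induct_at_least)
    case base
    show ?case using left by blast
  next
    case (Suc a)
    show ?case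
    proof (intro allI impI)
      fix b assume "b \<ge> b0"
      then show "h (Suc a) b \<ge> 0"
      proof (induction b rule: nat_induct_at_least)
        case base
        show ?case using bottom Suc by simp
      next
        case (Suc b)
        have "(f (Suc a) + f (Suc b)) * h (Suc a) (Suc b) =
           f (Suc a) * h a (Suc b) + f (Suc b) * h (Suc a) b"
          using har \<open>a0 \<le> a\<close> Suc.hyps unfolding backward_harmonic_def by blast
        also have "\<dots> \<ge> 0"
          using pos[of "Suc a"] pos[of "Suc b"] Suc \<open>\<forall>b\<ge>b0. h a b \<ge> 0\<close> by simp
        finally show ?case using pos[of "Suc a"] pos[of "Suc b"]
          by (simp add: zero_le_mult_iff)
      qed
    qed
  qed
  then show ?thesis using \<open>b \<ge> b0\<close> by blast
qed

lemma backward_harmonic_bounded: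
  assumes pos: "\<And>n. n \<ge> 1 \<Longrightarrow> f n > 0" and har: "backward_harmonic f a0 b0 h"
    and left: "\<And>b. b \<ge> b0 \<Longrightarrow> \<bar>h a0 b\<bar> \<le> C" and bottom: "\<And>a. a \<ge> a0 \<Longrightarrow> \<bar>h a b0\<bar> \<le> C"
    and ab: "a \<ge> a0" "b \<ge> b0"
  shows "\<bar>h a b\<bar> \<le> C"
proof -
  have "0 \<le> C + 1 * h a b"
    using left bottom
    by (intro backward_harmonic_nonneg[OF pos backward_harmonic_affine[OF har] _ _ ab])
      (force simp: abs_le_iff)+
  moreover have "0 \<le> C + (-1) * h a b"
    using left bottom
    by (intro backward_harmonic_nonneg[OF pos backward_harmonic_affine[OF har] _ _ ab])
      (force simp: abs_le_iff)+
  ultimately show ?thesis by (simp add: abs_le_iff)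
qed

text \<open>The mean value equation turns the new increment into a multiple of the antidiagonal
  difference \<open>h (Suc (Suc a)) (Suc b) - h (Suc a) (Suc (Suc b))\<close>. Splitting it at the
  corner \<open>h (Suc a) (Suc b)\<close> leaves one increment in each direction, and
  \<open>e1\<close> trades the vertical one for a horizontal one.\<close>

lemma backward_harmonic_increment:
  assumes pos: "\<And>n. n \<ge> 1 \<Longrightarrow> f n > 0" and har: "backward_harmonic f a0 b0 h"
  shows "backward_harmonic f (Suc a0) (Suc b0) (\<lambda>a b. f a * (h a b - h (a - 1) b))"
  unfolding backward_harmonic_def
proof (intro allI impI)
  fix a' b' assume "a' \<ge> Suc a0" "b' \<ge> Suc b0"
  then obtain a b where ab: "a' = Suc a" "b' = Suc b" "a \<ge> a0" "b \<ge> b0"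
    by (metis Suc_le_D Suc_le_mono)
  define u v where "u = f (Suc (Suc a))" and "v = f (Suc (Suc b))"
  have uv: "u > 0" "v > 0" using pos by (auto simp: u_def v_def)
  have h1: "(u + v) * h (Suc (Suc a)) (Suc (Suc b)) =
      u * h (Suc a) (Suc (Suc b)) + v * h (Suc (Suc a)) (Suc b)"
    using har ab unfolding backward_harmonic_def u_def v_def by simp
  have h2: "(f (Suc a) + v) * h (Suc a) (Suc (Suc b)) =
      f (Suc a) * h a (Suc (Suc b)) + v * h (Suc a) (Suc b)"
    using har ab unfolding backward_harmonic_def v_def by simp
  have e1: "f (Suc a) * (h (Suc a) (Suc (Suc b)) - h a (Suc (Suc b))) =
      v * (h (Suc a) (Suc b) - h (Suc a) (Suc (Suc b)))"
    using h2 by (simp add: algebra_simps)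
  have "(u + v) * (u * (h (Suc (Suc a)) (Suc (Suc b)) - h (Suc a) (Suc (Suc b)))) =
      u * (v * (h (Suc (Suc a)) (Suc b) - h (Suc a) (Suc (Suc b))))"
    using h1 by algebra
  also have "\<dots> = u * (v * (h (Suc a) (Suc b) - h (Suc a) (Suc (Suc b)))) +
      v * (u * (h (Suc (Suc a)) (Suc b) - h (Suc a) (Suc b)))"
    by (simp add: algebra_simps)
  finally show "(f (Suc a') + f (Suc b')) * (f (Suc a') * (h (Suc a') (Suc b') - h (Suc a' - 1) (Suc b'))) =
      f (Suc a') * (f a' * (h a' (Suc b') - h (a' - 1) (Suc b'))) +
      f (Suc b') * (f (Suc a') * (h (Suc a') b' - h (Suc a' - 1) b'))"
    using e1 by (simp add: ab flip: u_def v_def)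
qed

text \<open>By \<open>backward_harmonic_increment\<close> and the maximum principle the increments of \<open>h\<close> are
  \<open>O(1 / f a)\<close> and \<open>O(1 / f b)\<close>, hence summable along every monotone lattice path.\<close>

lemma backward_harmonic_convergent:
  assumes pos: "\<And>n. n \<ge> 1 \<Longrightarrow> f n > 0" and har: "backward_harmonic f a0 b0 h"
    and sum: "summable (\<lambda>n. 1 / f n)"
    and bd: "\<And>a b. a \<ge> a0 \<Longrightarrow> b \<ge> b0 \<Longrightarrow> \<bar>h a b\<bar> \<le> min (f a) (f b)"
  obtains l where "\<And>e. e > 0 \<Longrightarrow> \<exists>N. \<forall>a\<ge>N. \<forall>b\<ge>N. \<bar>h a b - l\<bar> < e"
proof -
  define E where "E = (\<lambda>a b. f a * (h a b - h (a - 1) b))"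
  have harE: "backward_harmonic f (Suc a0) (Suc b0) E"
    unfolding E_def by (rule backward_harmonic_increment[OF pos har])
  have flip: "E a b = f b * (h a (b - 1) - h a b)" if "a \<ge> Suc a0" "b \<ge> Suc b0" for a b
  proof -
    obtain a' b' where ab: "a = Suc a'" "b = Suc b'" "a' \<ge> a0" "b' \<ge> b0"
      using \<open>a \<ge> Suc a0\<close> \<open>b \<ge> Suc b0\<close> by (metis Suc_le_D Suc_le_mono)
    have "(f a + f b) * h a b = f a * h (a - 1) b + f b * h a (b - 1)"
      using har ab unfolding backward_harmonic_def by simp
    then show ?thesis by (simp add: E_def algebra_simps)
  qed
  \<comment> \<open>On the left line the bound \<open>f a\<close> on \<open>h\<close> does not
    depend on \<open>b\<close>; on the bottom line \<open>flip\<close> lets the bound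
    \<open>f b\<close> play the same role.\<close>
  define C where "C = max (f (Suc a0) * (f (Suc a0) + f a0)) (f (Suc b0) * (f (Suc b0) + f b0))"
  have E_bd: "\<bar>E a b\<bar> \<le> C" if "a \<ge> Suc a0" "b \<ge> Suc b0" for a b
  proof (rule backward_harmonic_bounded[OF pos harE _ _ that])
    fix b assume b: "b \<ge> Suc b0"
    have "\<bar>E (Suc a0) b\<bar> = f (Suc a0) * \<bar>h (Suc a0) b - h a0 b\<bar>"
      using pos[of "Suc a0"] by (simp add: E_def abs_mult)
    also have "\<dots> \<le> f (Suc a0) * (f (Suc a0) + f a0)"
      using pos[of "Suc a0"] bd[of "Suc a0" b] bd[of a0 b] b by (intro mult_left_mono) auto
    finally show "\<bar>E (Suc a0) b\<bar> \<le> C" by (simp add: C_def)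
  next
    fix a assume a: "a \<ge> Suc a0"
    have "\<bar>E a (Suc b0)\<bar> = f (Suc b0) * \<bar>h a b0 - h a (Suc b0)\<bar>"
      using pos[of "Suc b0"] flip[OF a, of "Suc b0"] by (simp add: abs_mult)
    also have "\<dots> \<le> f (Suc b0) * (f (Suc b0) + f b0)"
      using pos[of "Suc b0"] bd[of a "Suc b0"] bd[of a b0] a by (intro mult_left_mono) auto
    finally show "\<bar>E a (Suc b0)\<bar> \<le> C" by (simp add: C_def)
  qed
  define R where "R n = (\<Sum>j<n. 1 / f (Suc j))" for n
  have sum': "summable (\<lambda>n. 1 / f (Suc n))" using sum by (subst summable_Suc_iff)
  define r where "r = (\<Sum>n. 1 / f (Suc n))"
  have Rlim: "R \<longlonglongrightarrow> r" unfolding R_def[abs_def] r_def by (rule summable_LIMSEQ[OF sum'])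
  have step1: "\<bar>h (Suc a) b - h a b\<bar> \<le> C * (R (Suc a) - R a)" if "a \<ge> a0" "b \<ge> Suc b0" for a b
  proof -
    have "f (Suc a) * \<bar>h (Suc a) b - h a b\<bar> \<le> C"
      using E_bd[of "Suc a" b] that pos[of "Suc a"] by (simp add: E_def abs_mult)
    then show ?thesis using pos[of "Suc a"] by (simp add: R_def field_simps)
  qed
  have step2: "\<bar>h a (Suc b) - h a b\<bar> \<le> C * (R (Suc b) - R b)" if "a \<ge> Suc a0" "b \<ge> b0" for a b
  proof -
    have "f (Suc b) * \<bar>h a (Suc b) - h a b\<bar> \<le> C"
      using E_bd[of a "Suc b"] flip[of a "Suc b"] that pos[of "Suc b"]
      by (simp add: abs_mult abs_minus_commute)
    then show ?thesis using pos[of "Suc b"] by (simp add: R_def field_simps)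
  qed
  define N0 where "N0 = Suc (max a0 b0)"
  have mv1: "\<bar>h a' b - h a b\<bar> \<le> C * (R a' - R a)" if "a \<ge> N0" "b \<ge> N0" "a' \<ge> a" for a a' b
    using \<open>a' \<ge> a\<close>
  proof (induction a' rule: nat_induct_at_least)
    case (Suc n)
    then have "\<bar>h (Suc n) b - h n b\<bar> \<le> C * (R (Suc n) - R n)"
      using that by (intro step1) (auto simp: N0_def)
    with Suc show ?case unfolding right_diff_distrib by linarith
  qed simp
  have mv2: "\<bar>h a b' - h a b\<bar> \<le> C * (R b' - R b)" if "a \<ge> N0" "b \<ge> N0" "b' \<ge> b" for a b b'
    using \<open>b' \<ge> b\<close>
  proof (induction b' rule: nat_induct_at_least)
    case (Suc n)
    then have "\<bar>h a (Suc n) - h a n\<bar> \<le> C * (R (Suc n) - R n)"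
      using that by (intro step2) (auto simp: N0_def)
    with Suc show ?case unfolding right_diff_distrib by linarith
  qed simp
  \<comment> \<open>The path from \<open>(a, b)\<close> to \<open>(n, n)\<close> passes through
    \<open>(n, b)\<close>.\<close>
  have mv: "\<bar>h n n - h a b\<bar> \<le> C * (2 * R n - R a - R b)"
    if "a \<ge> N0" "b \<ge> N0" "n \<ge> a" "n \<ge> b" for a b n
    using mv1[of a b n] mv2[of n b n] that unfolding right_diff_distrib by linarith
  have "Cauchy (\<lambda>n. h (n + N0) (n + N0))"
  proof (rule metric_CauchyI)
    fix e :: real assume e: "e > 0"
    have "C \<ge> 0" using E_bd[of "Suc a0" "Suc b0"] by linarith
    have "Cauchy R" using Rlim by (simp add: LIMSEQ_imp_Cauchy)
    \<comment> \<open>Only \<open>C >= 0\<close> is at hand; \<open>C + 1\<close> keeps the divisor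
      positive.\<close>
    then obtain M where M: "\<And>m n. m \<ge> M \<Longrightarrow> n \<ge> M \<Longrightarrow> \<bar>R m - R n\<bar> < e / (2 * (C + 1))"
      using e \<open>C \<ge> 0\<close> unfolding Cauchy_def dist_real_def
      by (metis add_nonneg_pos divide_pos_pos mult_pos_pos zero_less_numeral zero_less_one)
    have *: "\<bar>h n n - h m m\<bar> < e" if "m \<ge> M" "m \<ge> N0" "n \<ge> m" for m n
    proof -
      have "\<bar>h n n - h m m\<bar> \<le> C * (2 * R n - R m - R m)" by (rule mv) (use that in auto)
      also have "\<dots> \<le> C * (2 * (e / (2 * (C + 1))))"
        using M[of n m] that \<open>C \<ge> 0\<close> by (intro mult_left_mono) auto
      also have "\<dots> < e" using \<open>C \<ge> 0\<close> e by (simp add: field_simps)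
      finally show ?thesis .
    qed
    show "\<exists>M. \<forall>m\<ge>M. \<forall>n\<ge>M. dist (h (m + N0) (m + N0)) (h (n + N0) (n + N0)) < e"
    proof (intro exI[of _ M] allI impI)
      fix m n assume "m \<ge> M" "n \<ge> M"
      then show "dist (h (m + N0) (m + N0)) (h (n + N0) (n + N0)) < e"
        using *[of "m + N0" "n + N0"] *[of "n + N0" "m + N0"]
        by (cases "m \<le> n") (auto simp: dist_real_def abs_minus_commute)
    qed
  qed
  then obtain l where "(\<lambda>n. h (n + N0) (n + N0)) \<longlonglongrightarrow> l" 
    by (auto simp: Cauchy_convergent_iff convergent_def)
  then have l: "(\<lambda>n. h n n) \<longlonglongrightarrow> l" by (rule LIMSEQ_offset)
  \<comment> \<open>Letting \<open>n\<close> tend to infinity with \<open>(a, b)\<close> fixed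
    carries the diagonal limit over to all pairs of large coordinates.\<close>
  have fin: "\<bar>l - h a b\<bar> \<le> C * (2 * r - R a - R b)" if "a \<ge> N0" "b \<ge> N0" for a b
  proof (rule LIMSEQ_le)
    show "(\<lambda>n. \<bar>h n n - h a b\<bar>) \<longlonglongrightarrow> \<bar>l - h a b\<bar>" by (intro tendsto_intros l)
    show "(\<lambda>n. C * (2 * R n - R a - R b)) \<longlonglongrightarrow> C * (2 * r - R a - R b)" by (intro tendsto_intros Rlim)
    show "\<exists>N. \<forall>n\<ge>N. \<bar>h n n - h a b\<bar> \<le> C * (2 * R n - R a - R b)"
      using mv that by (intro exI[of _ "max a b"]) auto
  qed
  show thesis
  proof (rule that)
    fix e :: real assume e: "e > 0"
    have "C \<ge> 0" using E_bd[of "Suc a0" "Suc b0"] by linarith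
    obtain M where M: "\<And>n. n \<ge> M \<Longrightarrow> \<bar>R n - r\<bar> < e / (2 * (C + 1))"
      using LIMSEQ_D[OF Rlim, of "e / (2 * (C + 1))"] e \<open>C \<ge> 0\<close> by auto
    show "\<exists>N. \<forall>a\<ge>N. \<forall>b\<ge>N. \<bar>h a b - l\<bar> < e"
    proof (intro exI[of _ "max M N0"] allI impI)
      fix a b assume ab: "a \<ge> max M N0" "b \<ge> max M N0"
      have "\<bar>l - h a b\<bar> \<le> C * (2 * r - R a - R b)" using fin ab by simp
      also have "\<dots> \<le> C * (2 * (e / (2 * (C + 1))))"
        using M[of a] M[of b] ab \<open>C \<ge> 0\<close> by (intro mult_left_mono) (auto simp: abs_less_iff)
      also have "\<dots> < e" using \<open>C \<ge> 0\<close> e by (simp add: field_simps)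
      finally show "\<bar>h a b - l\<bar> < e" by linarith
    qed
  qed
qed

text \<open>Let \<open>R\<close> and \<open>S\<close> be the partial sums of \<open>1 / f\<close> and \<open>1 / f\<^sup>2\<close>. For the walk from \<open>(a, b)\<close> that
  decreases a coordinate with probability proportional to its \<open>f\<close>-value, \<open>R a - R b\<close> is a martingale and
  \<open>(R a - R b)\<^sup>2 + S a + S b\<close> its compensated square. A Chebyshev bound therefore says that the walk,
  started far out on the diagonal, enters \<open>{a = N} \<union> {b = N}\<close> with probability at least \<open>1/2\<close> in a
  fixed finite set, on which \<open>h\<close> is bounded below by some \<open>\<epsilon>\<close>. In the proof this is a comparison of
  \<open>h\<close> with the harmonic function \<open>\<epsilon> - \<epsilon> / (t / 2)\<^sup>2 * W\<close>.\<close>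

lemma backward_harmonic_diagonal_bound:
  assumes pos: "\<And>n. n \<ge> 1 \<Longrightarrow> f n > 0" and mono: "mono_on {1..} f"
    and har: "backward_harmonic f a0 b0 h"
    and hpos: "\<And>a b. a \<ge> a0 \<Longrightarrow> b \<ge> b0 \<Longrightarrow> h a b > 0"
    and sum: "summable (\<lambda>n. 1 / f n)"
    and tail: "filterlim (\<lambda>n. f n * (\<Sum>j. 1 / f (n + j))) at_top sequentially"
  shows "\<exists>d>0. \<exists>N. \<forall>n\<ge>N. h n n \<ge> d"
proof -
  \<comment> \<open>The threshold 16 is what yields \<open>W n n <= 2 * (t / q) <= t * t / 8\<close>
    below, which is half of the square of \<open>t / 2\<close>.\<close>
  have "\<forall>\<^sub>F n in sequentially. n \<ge> Suc (max a0 b0) \<and> f n * (\<Sum>j. 1 / f (n + j)) \<ge> 16"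
    using tail unfolding filterlim_at_top by (intro eventually_conj eventually_ge_at_top) auto
  then obtain N' where "N' \<ge> Suc (max a0 b0)" "f N' * (\<Sum>j. 1 / f (N' + j)) \<ge> 16"
    using eventually_happens'[OF sequentially_bot] by blast
  then obtain N where N: "N \<ge> a0" "N \<ge> b0" and t16: "f (Suc N) * (\<Sum>j. 1 / f (Suc N + j)) \<ge> 16"
    by (metis Suc_le_D Suc_le_mono max.bounded_iff)
  define t where "t = (\<Sum>j. 1 / f (Suc N + j))"
  define q where "q = f (Suc N)"
  have q: "q > 0" using pos by (simp add: q_def)
  have tq: "q * t \<ge> 16" using t16 by (simp add: t_def q_def)
  then have t: "t > 0" using q by (smt (verit) mult_nonneg_nonpos)
  define R where "R n = (\<Sum>j<n. 1 / f (Suc j))" for n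
  define S where "S n = (\<Sum>j<n. (1 / f (Suc j))\<^sup>2)" for n
  have sum': "summable (\<lambda>j. 1 / f (Suc N + j))"
    using summable_iff_shift[of "\<lambda>n. 1 / f n" "Suc N"] sum by (simp add: add.commute)
  have Rdiff: "R (N + n) - R N = (\<Sum>j<n. 1 / f (Suc N + j))" for n
    by (induction n) (auto simp: R_def algebra_simps)
  have Rle: "R (N + n) - R N \<le> t" for n
    unfolding Rdiff t_def
    using pos by (intro sum_le_suminf[OF sum']) (auto intro!: less_imp_le)
  have Slim: "S (N + n) - S N \<le> t / q" for n
  proof -
    have "S (N + n) - S N \<le> (R (N + n) - R N) / q"
    proof (induction n)
      case (Suc n)
      have "q \<le> f (Suc (N + n))" using mono unfolding q_def by (auto simp: mono_on_def)
      then have "(1 / f (Suc (N + n)))\<^sup>2 \<le> (1 / f (Suc (N + n))) / q"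
        using q by (simp add: power2_eq_square field_simps mult_left_mono)
      with Suc show ?case by (simp add: S_def R_def diff_divide_distrib add_divide_distrib)
    qed simp
    also have "\<dots> \<le> t / q" using Rle q by (simp add: divide_right_mono)
    finally show ?thesis .
  qed
  have Smono: "S N \<le> S b" if "b \<ge> N" for b
    unfolding S_def using that by (intro sum_mono2) auto
  have "(\<lambda>n. R (N + n) - R N) \<longlonglongrightarrow> t"
    unfolding Rdiff t_def by (rule summable_LIMSEQ[OF sum'])
  then have "\<forall>\<^sub>F n in sequentially. R (N + n) - R N > t / 2"
    by (rule order_tendstoD) (use t in simp)
  then obtain B where B: "\<And>n. n \<ge> B \<Longrightarrow> R (N + n) - R N > t / 2"
    by (auto simp: eventually_sequentially)
  \<comment> \<open>Boundary points with \<open>R b - R N\<close> at most \<open>t / 2\<close> lie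
    within distance \<open>B\<close> of the corner, so finitely many values of \<open>h\<close>
    matter there. The element 1 makes \<open>A\<close> visibly nonempty.\<close>
  define A where "A = insert 1 ((\<lambda>n. min (h N (N + n)) (h (N + n) N)) ` {..<B})"
  define \<epsilon> where "\<epsilon> = Min A"
  have "finite A" "A \<noteq> {}" by (auto simp: A_def)
  have eps: "\<epsilon> > 0" unfolding \<epsilon>_def using \<open>finite A\<close> N hpos by (auto simp: A_def)
  have eps_le: "\<epsilon> \<le> h N b \<and> \<epsilon> \<le> h b N" if "b \<ge> N" "R b - R N \<le> t / 2" for b
  proof -
    have "b - N < B" using B[of "b - N"] that by (cases "b - N < B") auto
    then have "min (h N b) (h b N) \<in> A" using that unfolding A_def
      by (intro insertI2 image_eqI[of _ _ "b - N"]) auto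
    then have "\<epsilon> \<le> min (h N b) (h b N)"
      unfolding \<epsilon>_def by (rule Min_le[OF \<open>finite A\<close>])
    then show ?thesis by simp
  qed
  \<comment> \<open>Subtracting \<open>2 * S N\<close> gives \<open>W N N = 0\<close>; since
    \<open>S\<close> increases, \<open>W\<close> on the boundary is at least the squared difference
    of \<open>R\<close>.\<close>
  define W where "W a b = (R a - R b)\<^sup>2 + S a + S b - 2 * S N" for a b
  have harW: "backward_harmonic f N N W"
    unfolding backward_harmonic_def
  proof (intro allI impI)
    fix a b
    have "f (Suc a) > 0" "f (Suc b) > 0" using pos by auto
    then show "(f (Suc a) + f (Suc b)) * W (Suc a) (Suc b) =
        f (Suc a) * W a (Suc b) + f (Suc b) * W (Suc a) b"
      by (simp add: W_def R_def S_def power2_eq_square field_simps)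
  qed
  have W_sym: "W a b = W b a" for a b by (simp add: W_def power2_commute)
  \<comment> \<open>Near the corner \<open>h\<close> is at least \<open>\<epsilon>\<close> and
    \<open>W\<close> is nonnegative. Farther out \<open>W\<close> is so large that the comparison
    function is at most 0, and positivity of \<open>h\<close> is enough.\<close>
  have W_bd: "\<epsilon> - \<epsilon> / (t / 2)\<^sup>2 * W N b \<le> h N b \<and> \<epsilon> - \<epsilon> / (t / 2)\<^sup>2 * W N b \<le> h b N" if "b \<ge> N" for b
  proof (cases "R b - R N \<le> t / 2")
    case True
    have "W N b \<ge> (R N - R b)\<^sup>2" using Smono[OF that] by (simp add: W_def)
    then have "W N b \<ge> 0" by (rule order.trans[OF zero_le_power2])
    then have "\<epsilon> / (t / 2)\<^sup>2 * W N b \<ge> 0" using eps by simp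
    then show ?thesis using eps_le[OF that True] by linarith
  next
    case False
    then have "(t / 2)\<^sup>2 \<le> (R b - R N)\<^sup>2" using t by (intro power_mono) auto
    then have "W N b \<ge> (t / 2)\<^sup>2" using Smono[OF that] by (simp add: W_def power2_commute)
    then have "\<epsilon> / (t / 2)\<^sup>2 * W N b \<ge> \<epsilon> / (t / 2)\<^sup>2 * (t / 2)\<^sup>2"
      using eps by (intro mult_left_mono) auto
    then have "\<epsilon> / (t / 2)\<^sup>2 * W N b \<ge> \<epsilon>" using t by simp
    moreover have "h N b > 0" "h b N > 0" using hpos N that by simp_all
    ultimately show ?thesis by linarith
  qed
  have low: "h n n \<ge> \<epsilon> / 2" if "n \<ge> N" for n
  proof -
    have har': "backward_harmonic f N N (\<lambda>a b. h a b - (\<epsilon> + (- (\<epsilon> / (t / 2)\<^sup>2)) * W a b))"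
      by (intro backward_harmonic_diff backward_harmonic_affine harW
          backward_harmonic_mono[OF har N])
    have "0 \<le> h n n - (\<epsilon> + (- (\<epsilon> / (t / 2)\<^sup>2)) * W n n)"
    proof (rule backward_harmonic_nonneg[OF pos har' _ _ that that])
      show "0 \<le> h N b - (\<epsilon> + (- (\<epsilon> / (t / 2)\<^sup>2)) * W N b)" if "b \<ge> N" for b
        using W_bd[OF that] by linarith
      show "0 \<le> h a N - (\<epsilon> + (- (\<epsilon> / (t / 2)\<^sup>2)) * W a N)" if "a \<ge> N" for a
        using W_bd[OF that] unfolding W_sym[of a N] by linarith
    qed
    moreover have "W n n \<le> (t / 2)\<^sup>2 / 2"
    proof -
      have "W n n \<le> 2 * (t / q)" using Slim[of "n - N"] that by (simp add: W_def)
      also have "t / q \<le> t * t / 16" using tq q t by (simp add: field_simps)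
      finally show ?thesis by (simp add: power2_eq_square)
    qed
    then have "\<epsilon> / (t / 2)\<^sup>2 * W n n \<le> \<epsilon> / (t / 2)\<^sup>2 * ((t / 2)\<^sup>2 / 2)"
      using eps by (intro mult_left_mono) auto
    then have "\<epsilon> / (t / 2)\<^sup>2 * W n n \<le> \<epsilon> / 2" using t by simp
    ultimately show ?thesis by simp
  qed
  then show ?thesis using eps by (intro exI[of _ "\<epsilon> / 2"]) auto
qed

subsection \<open>Tails of series\<close>

text \<open>The quotient is the mean of the \<open>z n i\<close> with weights \<open>w n i\<close>,
  so uniform closeness of \<open>z n\<close> to \<open>l\<close> passes to it.\<close>

lemma weighted_average_tendsto:
  fixes w z :: "nat \<Rightarrow> nat \<Rightarrow> real"
  assumes w: "\<forall>\<^sub>F n in sequentially. summable (w n) \<and> (\<forall>i. w n i > 0)"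
    and z: "\<And>e. e > 0 \<Longrightarrow> \<forall>\<^sub>F n in sequentially. \<forall>i. \<bar>z n i - l\<bar> < e"
    and s: "\<forall>\<^sub>F n in sequentially. (\<lambda>i. z n i * w n i) sums s n"
  shows "(\<lambda>n. s n / (\<Sum>i. w n i)) \<longlonglongrightarrow> l"
proof (rule tendstoI)
  fix e :: real assume "e > 0"
  then have "\<forall>\<^sub>F n in sequentially. \<forall>i. \<bar>z n i - l\<bar> < e / 2" using z[of "e / 2"] by simp
  with s w show "\<forall>\<^sub>F n in sequentially. dist (s n / (\<Sum>i. w n i)) l < e"
  proof eventually_elim
    case (elim n)
    let ?W = "\<Sum>i. w n i"
    have w: "summable (w n)" "w n i > 0" for i using elim(2) by auto
    have W: "?W > 0" using w by (intro suminf_pos) auto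
    have sw: "(\<lambda>i. c * w n i) sums (c * ?W)" for c
      using w(1) by (intro sums_mult summable_sums)
    have "s n \<le> (l + e / 2) * ?W"
      by (rule sums_le[OF _ elim(1) sw])
        (use elim(3) w(2) in \<open>intro mult_right_mono; simp add: abs_less_iff less_imp_le; smt (verit)\<close>)
    moreover have "s n \<ge> (l - e / 2) * ?W"
      by (rule sums_le[OF _ sw elim(1)])
        (use elim(3) w(2) in \<open>intro mult_right_mono; simp add: abs_less_iff less_imp_le; smt (verit)\<close>)
    ultimately have "s n / ?W \<le> l + e / 2" "s n / ?W \<ge> l - e / 2"
      using W by (simp_all add: pos_divide_le_eq pos_le_divide_eq)
    then have "\<bar>s n / ?W - l\<bar> \<le> e / 2" by linarith
    then show ?case using \<open>e > 0\<close> by (simp add: dist_real_def)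
  qed
qed

text \<open>The decrement is the integral of \<open>t powr (-p)\<close> from \<open>n\<close> to
  \<open>n + 1\<close>, where the integrand is asymptotically constant.\<close>

lemma powr_increment_asymp:
  fixes p :: real assumes "p > 1"
  shows "(\<lambda>n. real n powr (-p) / (real n powr (1 - p) / (p - 1) - real (Suc n) powr (1 - p) / (p - 1)))
    \<longlonglongrightarrow> 1"
  using assms by real_asymp (simp add: divide_simps)

text \<open>The decrements of \<open>a\<close> telescope to exactly \<open>a n\<close> and are
  asymptotic to \<open>1 / f n\<close>. As weights in \<open>weighted_average_tendsto\<close> they
  carry the asymptotics from the terms to the tails.\<close>

lemma tail_sum_powr_asymp:
  fixes f :: "nat \<Rightarrow> real"
  assumes p: "p > 1" and f: "f \<sim>[at_top] (\<lambda>n. real n powr p)"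
  shows "summable (\<lambda>n. 1 / f n)"
    and "(\<lambda>n. (\<Sum>j. 1 / f (n + j)) / (real n powr (1 - p) / (p - 1))) \<longlonglongrightarrow> 1"
proof -
  define a where "a n = real n powr (1 - p) / (p - 1)" for n
  have "(\<lambda>n. 1 / f n) \<sim>[at_top] (\<lambda>n. 1 / real n powr p)"
    by (intro asymp_equiv_intros f)
  then have inv: "(\<lambda>n. 1 / f n) \<sim>[at_top] (\<lambda>n. real n powr (-p))"
    by (simp add: powr_minus_divide)
  show sum: "summable (\<lambda>n. 1 / f n)"
  proof (rule summable_comparison_test_bigo)
    show "summable (\<lambda>n. norm (real n powr (-p)))" using p by (simp add: summable_real_powr_iff)
    show "(\<lambda>n. 1 / f n) \<in> O(\<lambda>n. real n powr (-p))" using inv by (rule asymp_equiv_imp_bigo)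
  qed
  have "(\<lambda>n. (1 / f n) / real n powr (-p)) \<longlonglongrightarrow> 1"
    by (rule asymp_equivD_strong[OF inv])
      (auto simp: eventually_sequentially intro!: exI[of _ 1])
  from tendsto_mult[OF this powr_increment_asymp[OF p]]
  have lim: "(\<lambda>n. (1 / f n) / real n powr (-p) * (real n powr (-p) / (a n - a (Suc n)))) \<longlonglongrightarrow> 1"
    by (simp add: a_def)
  have q: "(\<lambda>n. (1 / f n) / (a n - a (Suc n))) \<longlonglongrightarrow> 1"
    by (rule Lim_transform_eventually[OF lim])
      (auto simp: eventually_sequentially intro!: exI[of _ 1])
  have a0: "a \<longlonglongrightarrow> 0" unfolding a_def[abs_def] using p by real_asymp
  have tel: "(\<lambda>i. a (n + i) - a (Suc (n + i))) sums a n" for n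
  proof -
    have "(\<lambda>i. a (n + i)) \<longlonglongrightarrow> 0"
      using LIMSEQ_ignore_initial_segment[OF a0, of n] by (simp add: add.commute)
    from telescope_sums'[OF this] show ?thesis by simp
  qed
  have dpos: "a j - a (Suc j) > 0" if "j \<ge> 1" for j
    using p that powr_less_mono2_neg[of "1 - p" "real j" "real (Suc j)"]
    by (simp add: a_def divide_strict_right_mono)
  have "(\<lambda>n. (\<Sum>j. 1 / f (n + j)) / (\<Sum>i. a (n + i) - a (Suc (n + i)))) \<longlonglongrightarrow> 1"
  proof (rule weighted_average_tendsto)
    show "\<forall>\<^sub>F n in sequentially. summable (\<lambda>i. a (n + i) - a (Suc (n + i))) \<and>
        (\<forall>i. a (n + i) - a (Suc (n + i)) > 0)"
      using sums_summable[OF tel] dpos by (auto simp: eventually_sequentially intro!: exI[of _ 1])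
    show "\<forall>\<^sub>F n in sequentially. \<forall>i. \<bar>(1 / f (n + i)) / (a (n + i) - a (Suc (n + i))) - 1\<bar> < e"
      if "e > 0" for e
    proof -
      obtain N where "\<And>n. n \<ge> N \<Longrightarrow> \<bar>(1 / f n) / (a n - a (Suc n)) - 1\<bar> < e"
        using LIMSEQ_D[OF q \<open>e > 0\<close>] by auto
      then show ?thesis by (auto simp: eventually_sequentially intro!: exI[of _ N])
    qed
    show "\<forall>\<^sub>F n in sequentially. (\<lambda>i. (1 / f (n + i)) / (a (n + i) - a (Suc (n + i))) *
        (a (n + i) - a (Suc (n + i)))) sums (\<Sum>j. 1 / f (n + j))"
    proof (rule eventually_sequentiallyI)
      fix n :: nat assume "n \<ge> 1"
      have "summable (\<lambda>i. 1 / f (n + i))"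
        using summable_iff_shift[of "\<lambda>n. 1 / f n" n] sum by (simp add: add.commute)
      then have "(\<lambda>i. 1 / f (n + i)) sums (\<Sum>j. 1 / f (n + j))" by (rule summable_sums)
      moreover have "(1 / f (n + i)) / (a (n + i) - a (Suc (n + i))) * (a (n + i) - a (Suc (n + i)))
          = 1 / f (n + i)" for i
        using dpos[of "n + i"] \<open>n \<ge> 1\<close> by simp
      ultimately show "(\<lambda>i. (1 / f (n + i)) / (a (n + i) - a (Suc (n + i))) *
        (a (n + i) - a (Suc (n + i)))) sums (\<Sum>j. 1 / f (n + j))" by simp
    qed
  qed
  then show "(\<lambda>n. (\<Sum>j. 1 / f (n + j)) / (real n powr (1 - p) / (p - 1))) \<longlonglongrightarrow> 1"
    using sums_unique[OF tel] by (simp add: a_def)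
qed

subsection \<open>Trajectories and the losing number\<close>

lemma measurable_coordinate [measurable]:
  "(\<lambda>\<omega>. \<omega> m) \<in> balls_bins f u \<rightarrow>\<^sub>M count_space UNIV"
  unfolding measurable_cong_sets[OF sets_balls_bins refl]
  by (rule measurable_component_singleton) simp

text \<open>The Markov property at a fixed time: \<open>measure_balls_bins_Suc\<close> prescribes
  the whole history, so one sums over all histories that end in \<open>s\<close>.\<close>

lemma measure_two_steps:
  "measure (balls_bins f u) {\<omega>. \<omega> m = s \<and> \<omega> (Suc m) = s'} =
     measure (balls_bins f u) {\<omega>. \<omega> m = s} * pmf (step f s) s'"
proof -
  interpret prob_space "balls_bins f u" by (rule prob_space_balls_bins)
  let ?N = "balls_bins f u"
  \<comment> \<open>Histories are finite lists, which makes the index set countable.\<close>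
  define I where "I = {l :: state list. length l = Suc m \<and> l ! m = s}"
  have cyl [measurable]: "{\<omega>. \<forall>i\<le>m. \<omega> i = t i} \<in> sets ?N"
    "{\<omega>. \<forall>i\<le>Suc m. \<omega> i = t i} \<in> sets ?N" for t
  proof -
    have "{\<omega> \<in> space ?N. \<forall>i\<le>k. \<omega> i = t i} \<in> sets ?N" for k by measurable
    then show "{\<omega>. \<forall>i\<le>m. \<omega> i = t i} \<in> sets ?N" "{\<omega>. \<forall>i\<le>Suc m. \<omega> i = t i} \<in> sets ?N"
      by simp_all
  qed
  have ex: "\<exists>l\<in>I. \<forall>i\<le>m. \<omega> i = l ! i" if "\<omega> m = s" for \<omega>
    by (rule bexI[of _ "map \<omega> [0..<Suc m]"]) (use that in \<open>auto simp: I_def simp del: upt_Suc\<close>)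
  have eq: "l = l'" if "l \<in> I" "l' \<in> I" "\<forall>i\<le>m. l ! i = l' ! i" for l l'
    using that by (auto simp: I_def intro!: nth_equalityI)
  have "emeasure ?N {\<omega>. \<omega> m = s \<and> \<omega> (Suc m) = s'} =
      emeasure ?N (\<Union>l\<in>I. {\<omega>. \<forall>i\<le>Suc m. \<omega> i = (l @ [s']) ! i})"
  proof (rule arg_cong[where f = "emeasure ?N"], intro set_eqI iffI)
    fix \<omega> assume "\<omega> \<in> {\<omega>. \<omega> m = s \<and> \<omega> (Suc m) = s'}"
    then show "\<omega> \<in> (\<Union>l\<in>I. {\<omega>. \<forall>i\<le>Suc m. \<omega> i = (l @ [s']) ! i})"
      using ex[of \<omega>] by (auto simp: I_def nth_append le_Suc_eq)
  qed (auto simp: I_def nth_append)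
  also have "\<dots> = (\<integral>\<^sup>+l. emeasure ?N {\<omega>. \<forall>i\<le>Suc m. \<omega> i = (l @ [s']) ! i} \<partial>count_space I)"
  proof (rule emeasure_UN_countable)
    have "l = l'" if "l \<in> I" "l' \<in> I" "\<forall>i\<le>Suc m. \<omega> i = (l @ [s']) ! i"
      "\<forall>i\<le>Suc m. \<omega> i = (l' @ [s']) ! i" for l l' \<omega>
    proof (rule eq[OF that(1,2)], intro allI impI)
      fix i assume "i \<le> m"
      then show "l ! i = l' ! i"
        using that(3,4)[rule_format, of i] that(1,2) by (simp add: I_def nth_append)
    qed
    then show "disjoint_family_on (\<lambda>l. {\<omega>. \<forall>i\<le>Suc m. \<omega> i = (l @ [s']) ! i}) I"
      unfolding disjoint_family_on_def by blast
  qed auto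
  also have "\<dots> = (\<integral>\<^sup>+l. emeasure ?N {\<omega>. \<forall>i\<le>m. \<omega> i = l ! i} * ennreal (pmf (step f s) s')
      \<partial>count_space I)"
  proof (rule nn_integral_cong)
    fix l assume "l \<in> space (count_space I)"
    then have l: "length l = Suc m" "l ! m = s" by (auto simp: I_def)
    have "{\<omega>. \<forall>i\<le>m. \<omega> i = (l @ [s']) ! i} = {\<omega>. \<forall>i\<le>m. \<omega> i = l ! i}"
      using l by (auto simp: nth_append)
    then show "emeasure ?N {\<omega>. \<forall>i\<le>Suc m. \<omega> i = (l @ [s']) ! i} =
        emeasure ?N {\<omega>. \<forall>i\<le>m. \<omega> i = l ! i} * ennreal (pmf (step f s) s')"
      using measure_balls_bins_Suc[of f u m "\<lambda>i. (l @ [s']) ! i"] l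
      by (simp add: emeasure_eq_measure ennreal_mult nth_append)
  qed
  also have "\<dots> = (\<integral>\<^sup>+l. emeasure ?N {\<omega>. \<forall>i\<le>m. \<omega> i = l ! i} \<partial>count_space I) *
      ennreal (pmf (step f s) s')"
    by (rule nn_integral_multc) simp
  also have "(\<integral>\<^sup>+l. emeasure ?N {\<omega>. \<forall>i\<le>m. \<omega> i = l ! i} \<partial>count_space I) =
      emeasure ?N (\<Union>l\<in>I. {\<omega>. \<forall>i\<le>m. \<omega> i = l ! i})"
    by (rule emeasure_UN_countable[symmetric])
      (auto simp: disjoint_family_on_def dest: eq)
  also have "(\<Union>l\<in>I. {\<omega>. \<forall>i\<le>m. \<omega> i = l ! i}) = {\<omega>. \<omega> m = s}"
    using ex by (auto simp: I_def)
  finally show ?thesis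
    by (simp add: emeasure_eq_measure flip: ennreal_mult')
qed

lemma add_ball_in_step: "s' \<in> set_pmf (step f s) \<Longrightarrow> s' = add_ball Bin1 s \<or> s' = add_ball Bin2 s"
proof -
  assume "s' \<in> set_pmf (step f s)"
  then obtain i where "s' = add_ball i s" by (auto simp: step_def)
  then show ?thesis by (cases i) auto
qed

definition bb_path :: "state \<Rightarrow> (nat \<Rightarrow> state) \<Rightarrow> bool" where
  "bb_path u \<omega> \<longleftrightarrow> \<omega> 0 = u \<and>
     (\<forall>m. \<omega> (Suc m) = add_ball Bin1 (\<omega> m) \<or> \<omega> (Suc m) = add_ball Bin2 (\<omega> m))"

lemma measurable_bb_path [measurable]: "Measurable.pred (balls_bins f u) (bb_path v)"
  unfolding bb_path_def[abs_def] by measurable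

text \<open>A forbidden pair of consecutive states has probability 0 by
  \<open>measure_two_steps\<close>, and there are only countably many triples of a time and two
  states.\<close>

lemma AE_bb_path: "AE \<omega> in balls_bins f u. bb_path u \<omega>"
proof -
  interpret prob_space "balls_bins f u" by (rule prob_space_balls_bins)
  let ?N = "balls_bins f u"
  have 0: "AE \<omega> in ?N. \<omega> 0 = u"
  proof (rule AE_I_eq_1)
    show "emeasure ?N {\<omega> \<in> space ?N. \<omega> 0 = u} = 1"
      by (simp add: emeasure_eq_measure measure_balls_bins_0)
  qed measurable
  have "AE \<omega> in ?N. \<forall>m s s'. \<omega> m = s \<and> \<omega> (Suc m) = s' \<longrightarrow> s' \<in> set_pmf (step f s)"
    unfolding AE_all_countable
  proof (intro allI)
    fix m :: nat and s s' :: state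
    show "AE \<omega> in ?N. \<omega> m = s \<and> \<omega> (Suc m) = s' \<longrightarrow> s' \<in> set_pmf (step f s)"
    proof (cases "s' \<in> set_pmf (step f s)")
      case False
      have "AE \<omega> in ?N. \<not> (\<omega> m = s \<and> \<omega> (Suc m) = s')"
      proof (rule AE_I[OF subset_refl])
        show "emeasure ?N {\<omega> \<in> space ?N. \<not> \<not> (\<omega> m = s \<and> \<omega> (Suc m) = s')} = 0"
          using measure_two_steps[of f u m s s'] False
          by (simp add: emeasure_eq_measure set_pmf_iff)
      qed measurable
      then show ?thesis by eventually_elim auto
    qed simp
  qed
  with 0 show ?thesis
  proof eventually_elim
    case (elim \<omega>)
    then have "\<omega> (Suc m) \<in> set_pmf (step f (\<omega> m))" for m by blast
    then have "\<omega> (Suc m) = add_ball Bin1 (\<omega> m) \<or> \<omega> (Suc m) = add_ball Bin2 (\<omega> m)" for m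
      by (metis (full_types) add_ball_in_step)
    then show ?case using elim(1) by (simp add: bb_path_def)
  qed
qed


lemma bb_path_step:
  assumes "bb_path u \<omega>"
  shows "\<omega> (Suc m) = (Suc (fst (\<omega> m)), snd (\<omega> m)) \<or> \<omega> (Suc m) = (fst (\<omega> m), Suc (snd (\<omega> m)))"
  using assms unfolding bb_path_def by (cases "\<omega> m") (metis add_ball.simps fst_conv snd_conv)

lemma bb_path_sum:
  assumes "bb_path u \<omega>"
  shows "fst (\<omega> m) + snd (\<omega> m) = fst u + snd u + m"
proof (induction m)
  case 0
  then show ?case using assms by (simp add: bb_path_def)
next
  case (Suc m)
  then show ?case using bb_path_step[OF assms, of m] by auto
qed

lemma bb_path_mono:
  assumes "bb_path u \<omega>" "m \<le> n"
  shows "fst (\<omega> m) \<le> fst (\<omega> n)" "snd (\<omega> m) \<le> snd (\<omega> n)"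
proof -
  have le: "fst (\<omega> m) \<le> fst (\<omega> (Suc m))" "snd (\<omega> m) \<le> snd (\<omega> (Suc m))" for m
    using bb_path_step[OF assms(1), of m] by auto
  show "fst (\<omega> m) \<le> fst (\<omega> n)"
    by (rule lift_Suc_mono_le[of "\<lambda>m. fst (\<omega> m)", OF le(1) \<open>m \<le> n\<close>])
  show "snd (\<omega> m) \<le> snd (\<omega> n)"
    by (rule lift_Suc_mono_le[of "\<lambda>m. snd (\<omega> m)", OF le(2) \<open>m \<le> n\<close>])
qed

lemma nat_mono_bounded_eventually_const:
  fixes X :: "nat \<Rightarrow> nat"
  assumes "mono X" "\<And>m. X m \<le> n"
  obtains k m0 where "\<And>m. m \<ge> m0 \<Longrightarrow> X m = k"
proof -
  have "finite (range X)" using assms(2) by (auto intro: finite_subset[OF _ finite_atMost[of n]])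
  then have "Max (range X) \<in> range X" by (intro Max_in) auto
  then obtain m0 where m0: "X m0 = Max (range X)" by force
  have "X m = Max (range X)" if "m \<ge> m0" for m
    using \<open>finite (range X)\<close> monoD[OF assms(1) that] m0 by (intro antisym) auto
  then show thesis by (rule that)
qed

lemma losing_number_eq:
  assumes l: "losing_bin \<omega> = l" and k: "\<And>m. m \<ge> m0 \<Longrightarrow> count_in l (\<omega> m) = k"
  shows "losing_number \<omega> = k"
proof -
  have "(\<lambda>m. count_in l (\<omega> m)) \<longlonglongrightarrow> k"
    using k by (intro tendsto_eventually) (auto simp: eventually_sequentially)
  then show ?thesis unfolding losing_number_def l by (rule limI)
qed

text \<open>Once the count of \<open>l\<close> is constant, each step feeds the other bin and
  differs from \<open>add_ball l\<close>, which gives the uniqueness that \<open>THE\<close>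
  requires.\<close>

lemma losing_bin_eq:
  assumes "bb_path u \<omega>" and k: "\<And>m. m \<ge> m0 \<Longrightarrow> count_in l (\<omega> m) = k"
  shows "losing_bin \<omega> = l"
proof -
  have st: "\<omega> (Suc m) = add_ball (other l) (\<omega> m) \<and> \<omega> (Suc m) \<noteq> add_ball l (\<omega> m)"
    if "m \<ge> m0" for m
    using bb_path_step[OF assms(1), of m] k[of m] k[of "Suc m"] that
    by (cases l; cases "\<omega> m"; cases "\<omega> (Suc m)") auto
  show ?thesis
    unfolding losing_bin_def
  proof (rule the_equality)
    show "\<forall>\<^sub>F m in sequentially. \<omega> (Suc m) = add_ball (other l) (\<omega> m)"
      using st by (auto simp: eventually_sequentially)
  next
    fix i assume "\<forall>\<^sub>F m in sequentially. \<omega> (Suc m) = add_ball (other i) (\<omega> m)"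
    moreover have "\<forall>\<^sub>F m in sequentially. m \<ge> m0" by (rule eventually_ge_at_top)
    ultimately have "\<forall>\<^sub>F m in sequentially. \<omega> (Suc m) = add_ball (other i) (\<omega> m) \<and> m \<ge> m0"
      by (rule eventually_conj)
    then obtain m where "\<omega> (Suc m) = add_ball (other i) (\<omega> m)" "m \<ge> m0"
      using eventually_happens'[OF sequentially_bot] by blast
    then have "other i \<noteq> l" using st[of m] by auto
    then show "i = l" by (cases i; cases l) auto
  qed
qed

text \<open>Stand-in for the event that the losing number exceeds \<open>n\<close>. It involves
  neither a limit nor a losing bin, so its probability can be computed directly.\<close>

definition both_exceed :: "nat \<Rightarrow> (nat \<Rightarrow> state) \<Rightarrow> bool" where
  "both_exceed n \<omega> \<longleftrightarrow> (\<exists>m. fst (\<omega> m) > n \<and> snd (\<omega> m) > n)"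

text \<open>By monotonicity one bin never exceeds \<open>n0\<close>. Its count becomes constant, so
  it loses, while the other count is unbounded because the total grows.\<close>

lemma losing_number_gt_iff:
  assumes path: "bb_path u \<omega>" and mon: "\<not> both_exceed n0 \<omega>"
  shows "losing_number \<omega> > n \<longleftrightarrow> both_exceed n \<omega>"
proof -
  define F S where "F m = fst (\<omega> m)" and "S m = snd (\<omega> m)" for m
  have FS: "mono F" "mono S" unfolding F_def S_def using bb_path_mono[OF path] by (auto intro: monoI)
  have sum: "F m + S m = fst u + snd u + m" for m
    using bb_path_sum[OF path] by (simp add: F_def S_def)
  have no: "\<not> (F m > n0 \<and> S m > n0)" for m using mon by (auto simp: both_exceed_def F_def S_def)
  have cnt: "count_in Bin1 s = fst s" "count_in Bin2 s = snd s" for s by (cases s; simp)+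
  \<comment> \<open>Symmetric form for both cases: \<open>X\<close> counts the losing bin
    \<open>l\<close>, \<open>Y\<close> the winning one.\<close>
  have main: "losing_number \<omega> > n \<longleftrightarrow> both_exceed n \<omega>"
    if XY: "mono X" "mono Y" "\<And>m. X m \<le> n0" and XYs: "\<And>m. X m + Y m = fst u + snd u + m"
      and X: "\<And>m. X m = count_in l (\<omega> m)"
      and be: "both_exceed n \<omega> \<longleftrightarrow> (\<exists>m. X m > n \<and> Y m > n)" for X Y l
  proof -
    obtain k m0 where k: "\<And>m. m \<ge> m0 \<Longrightarrow> X m = k"
      by (rule nat_mono_bounded_eventually_const[OF XY(1) XY(3)]) blast
    have cl: "count_in l (\<omega> m) = k" if "m \<ge> m0" for m using k[OF that] X[of m] by simp
    have "losing_bin \<omega> = l" by (rule losing_bin_eq[OF path cl])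
    then have L: "losing_number \<omega> = k" by (rule losing_number_eq[OF _ cl])
    show ?thesis
      unfolding L be
    proof
      assume "n < k"
      \<comment> \<open>At this time \<open>X\<close> equals \<open>k\<close> and the total exceeds
        \<open>k + n\<close>, hence \<open>Y\<close> exceeds \<open>n\<close>.\<close>
      then show "\<exists>m. n < X m \<and> n < Y m"
        using k[of "m0 + k + n + 1"] XYs[of "m0 + k + n + 1"]
        by (intro exI[of _ "m0 + k + n + 1"]) linarith
    next
      assume "\<exists>m. n < X m \<and> n < Y m"
      then obtain m where "n < X m" by blast
      also have "X m \<le> X (m + m0)" by (rule monoD[OF XY(1)]) simp
      also have "X (m + m0) = k" by (rule k) simp
      finally show "n < k" .
    qed
  qed
  have "(\<forall>m. F m \<le> n0) \<or> (\<forall>m. S m \<le> n0)"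
  proof (rule ccontr)
    assume "\<not> ?thesis"
    then obtain m m' where "F m > n0" "S m' > n0" by (auto simp: not_le)
    then have "F (max m m') > n0" "S (max m m') > n0"
      using monoD[OF FS(1), of m "max m m'"] monoD[OF FS(2), of m' "max m m'"] by auto
    with no show False by blast
  qed
  then show ?thesis
  proof
    assume "\<forall>m. F m \<le> n0"
    then show ?thesis
      by (intro main[of F S Bin1]) (use FS sum in \<open>simp_all add: both_exceed_def F_def S_def cnt\<close>)
  next
    assume "\<forall>m. S m \<le> n0"
    then show ?thesis
      by (intro main[of S F Bin2])
        (use FS sum in \<open>simp_all add: both_exceed_def F_def S_def cnt add.commute conj_commute\<close>)
  qed
qed

subsection \<open>Visit probabilities\<close>

lemma measurable_both_exceed [measurable]:
  "Measurable.pred (balls_bins f u) (both_exceed n)"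
  unfolding both_exceed_def[abs_def] by measurable

lemma pmf_step_add_ball:
  assumes "f (fst s) > 0" "f (snd s) > 0"
  shows "pmf (step f s) (add_ball i s) = f (count_in i s) / (f (fst s) + f (snd s))"
proof -
  have cnt: "count_in Bin1 s = fst s" "count_in Bin2 s = snd s" by (cases s; simp)+
  have "add_ball Bin1 s \<noteq> add_ball Bin2 s" by (cases s) auto
  then have "inj (\<lambda>i. add_ball i s)" by (intro injI) (metis bin.exhaust)
  from pmf_map_inj'[OF this, of "choose_bin f s" i] show ?thesis
    unfolding step_def by (simp add: pmf_choose_bin assms cnt)
qed

text \<open>The sum of the coordinates grows by one in each step, so \<open>(a, b)\<close> can only be visited at time
  \<open>a + b - fst u - snd u\<close>; the truncated subtraction makes this definition meaningful only for
  \<open>a \<ge> fst u\<close> and \<open>b \<ge> snd u\<close>.\<close>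

definition visit_prob :: "(nat \<Rightarrow> real) \<Rightarrow> state \<Rightarrow> nat \<Rightarrow> nat \<Rightarrow> real" where
  "visit_prob f u a b = measure (balls_bins f u) {\<omega>. \<omega> (a + b - fst u - snd u) = (a, b)}"

text \<open>In the exponential embedding, where bin \<open>i\<close> waits an exponential time of rate \<open>f k\<close> with \<open>k\<close>
  balls, this is the density at \<open>0\<close> of the difference of the times at which the two bins leave the
  levels \<open>a\<close> and \<open>b\<close>.\<close>

definition crossing_density :: "(nat \<Rightarrow> real) \<Rightarrow> state \<Rightarrow> nat \<Rightarrow> nat \<Rightarrow> real" where
  "crossing_density f u a b = f a * f b / (f a + f b) * visit_prob f u a b"

context
  fixes f :: "nat \<Rightarrow> real" and x y :: nat
  assumes pos: "\<And>n. n \<ge> 1 \<Longrightarrow> f n > 0" and x1: "x \<ge> 1" and y1: "y \<ge> 1"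
begin

lemma measure_step_Bin1:
  assumes "a \<ge> x" "b \<ge> y" "m = a + b - x - y"
  shows "measure (balls_bins f (x, y)) {\<omega>. \<omega> m = (a, b) \<and> \<omega> (Suc m) = (Suc a, b)} =
     visit_prob f (x, y) a b * (f a / (f a + f b))"
  using pmf_step_add_ball[of f "(a, b)" Bin1] pos[of a] pos[of b] x1 y1 assms
  by (simp add: measure_two_steps visit_prob_def)

lemma measure_step_Bin2:
  assumes "a \<ge> x" "b \<ge> y" "m = a + b - x - y"
  shows "measure (balls_bins f (x, y)) {\<omega>. \<omega> m = (a, b) \<and> \<omega> (Suc m) = (a, Suc b)} =
     visit_prob f (x, y) a b * (f b / (f a + f b))"
  using pmf_step_add_ball[of f "(a, b)" Bin2] pos[of a] pos[of b] x1 y1 assms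
  by (simp add: measure_two_steps visit_prob_def)

lemma visit_prob_le_1: "visit_prob f (x, y) a b \<le> 1"
  unfolding visit_prob_def by (rule prob_space.prob_le_1[OF prob_space_balls_bins])

lemma visit_prob_Suc_left:
  assumes "a \<ge> x" "b \<ge> y"
  shows "visit_prob f (x, y) (Suc a) b \<ge> visit_prob f (x, y) a b * (f a / (f a + f b))"
proof -
  interpret prob_space "balls_bins f (x, y)" by (rule prob_space_balls_bins)
  define m where "m = a + b - x - y"
  have m: "Suc a + b - x - y = Suc m" using assms by (simp add: m_def)
  have "{\<omega> \<in> space (balls_bins f (x, y)). \<omega> (Suc m) = (Suc a, b)} \<in> events" by measurable
  then show ?thesis
    unfolding visit_prob_def[of f "(x, y)" "Suc a" b] fst_conv snd_conv m
      measure_step_Bin1[OF assms m_def, symmetric]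
    by (auto intro!: finite_measure_mono)
qed

lemma visit_prob_Suc_right:
  assumes "a \<ge> x" "b \<ge> y"
  shows "visit_prob f (x, y) a (Suc b) \<ge> visit_prob f (x, y) a b * (f b / (f a + f b))"
proof -
  interpret prob_space "balls_bins f (x, y)" by (rule prob_space_balls_bins)
  define m where "m = a + b - x - y"
  have m: "a + Suc b - x - y = Suc m" using assms by (simp add: m_def)
  have "{\<omega> \<in> space (balls_bins f (x, y)). \<omega> (Suc m) = (a, Suc b)} \<in> events" by measurable
  then show ?thesis
    unfolding visit_prob_def[of f "(x, y)" a "Suc b"] fst_conv snd_conv m
      measure_step_Bin2[OF assms m_def, symmetric]
    by (auto intro!: finite_measure_mono)
qed

text \<open>A single lattice path suffices: first from \<open>(x, y)\<close> to
  \<open>(a, y)\<close>, then to \<open>(a, b)\<close>.\<close>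

lemma visit_prob_pos:
  assumes "a \<ge> x" "b \<ge> y"
  shows "visit_prob f (x, y) a b > 0"
proof -
  have "visit_prob f (x, y) a y > 0" using \<open>a \<ge> x\<close>
  proof (induction a rule: nat_induct_at_least)
    case base
    then show ?case using measure_balls_bins_0[of f "(x, y)"] by (simp add: visit_prob_def)
  next
    case (Suc a)
    then have "visit_prob f (x, y) a y * (f a / (f a + f y)) > 0"
      using pos[of a] pos[of y] x1 y1 by simp
    then show ?case using visit_prob_Suc_left[of a y] Suc by simp
  qed
  with \<open>b \<ge> y\<close> show ?thesis
  proof (induction b rule: nat_induct_at_least)
    case (Suc b)
    then have "visit_prob f (x, y) a b * (f b / (f a + f b)) > 0"
      using pos[of a] pos[of b] x1 y1 assms by simp
    then show ?case using visit_prob_Suc_right[of a b] Suc assms by simp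
  qed
qed

text \<open>Kolmogorov forward equation, by the last step. Both predecessors have the same
  coordinate sum, hence the same time \<open>m\<close>; that no other predecessor occurs holds
  almost surely.\<close>

lemma visit_prob_Suc_Suc:
  assumes ab: "a \<ge> x" "b \<ge> y"
  shows "visit_prob f (x, y) (Suc a) (Suc b) =
     visit_prob f (x, y) a (Suc b) * (f a / (f a + f (Suc b))) +
     visit_prob f (x, y) (Suc a) b * (f b / (f (Suc a) + f b))"
proof -
  let ?N = "balls_bins f (x, y)"
  interpret prob_space ?N by (rule prob_space_balls_bins)
  define m where "m = a + Suc b - x - y"
  have m: "Suc a + Suc b - x - y = Suc m" "m = Suc a + b - x - y" using ab by (auto simp: m_def)
  define A where "A = {\<omega>. \<omega> m = (a, Suc b) \<and> \<omega> (Suc m) = (Suc a, Suc b)}"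
  define B where "B = {\<omega>. \<omega> m = (Suc a, b) \<and> \<omega> (Suc m) = (Suc a, Suc b)}"
  have "{\<omega> \<in> space ?N. \<omega> m = s \<and> \<omega> (Suc m) = s'} \<in> events" for s s' by measurable
  then have AB: "A \<in> events" "B \<in> events" by (simp_all add: A_def B_def)
  have "{\<omega> \<in> space ?N. \<omega> (Suc m) = (Suc a, Suc b)} \<in> events" by measurable
  then have "prob {\<omega>. \<omega> (Suc m) = (Suc a, Suc b)} = prob (A \<union> B)"
  proof (intro finite_measure_eq_AE)
    show "AE \<omega> in ?N. (\<omega> \<in> {\<omega>. \<omega> (Suc m) = (Suc a, Suc b)}) = (\<omega> \<in> A \<union> B)"
      using AE_bb_path
    proof eventually_elim
      case (elim \<omega>)
      then show ?case
        using bb_path_step[OF elim, of m] by (cases "\<omega> m") (auto simp: A_def B_def)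
    qed
  qed (use AB in auto)
  also have "\<dots> = prob A + prob B"
    using AB by (intro finite_measure_Union) (auto simp: A_def B_def)
  also have "prob A = visit_prob f (x, y) a (Suc b) * (f a / (f a + f (Suc b)))"
    unfolding A_def using ab by (intro measure_step_Bin1) (auto simp: m_def)
  also have "prob B = visit_prob f (x, y) (Suc a) b * (f b / (f (Suc a) + f b))"
    unfolding B_def using ab m by (intro measure_step_Bin2) auto
  finally show ?thesis unfolding visit_prob_def[of _ _ "Suc a" "Suc b"] by (simp only: fst_conv snd_conv m)
qed

text \<open>The factor in \<open>crossing_density\<close> absorbs the forward transition
  probabilities: \<open>f (Suc b) * (f a / (f a + f (Suc b)))\<close> times the visit probability of
  \<open>(a, Suc b)\<close> is the density at that point.\<close>

lemma crossing_density_harmonic: "backward_harmonic f x y (crossing_density f (x, y))"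
  unfolding backward_harmonic_def
proof (intro allI impI)
  fix a b assume ab: "a \<ge> x" "b \<ge> y"
  have p: "f a > 0" "f b > 0" "f (Suc a) > 0" "f (Suc b) > 0" using pos ab x1 y1 by simp_all
  have "(f (Suc a) + f (Suc b)) * crossing_density f (x, y) (Suc a) (Suc b) =
      f (Suc a) * f (Suc b) * visit_prob f (x, y) (Suc a) (Suc b)"
    using p by (simp add: crossing_density_def)
  also have "\<dots> = f (Suc a) * crossing_density f (x, y) a (Suc b) +
      f (Suc b) * crossing_density f (x, y) (Suc a) b"
    unfolding visit_prob_Suc_Suc[OF ab] crossing_density_def by (simp add: algebra_simps)
  finally show "(f (Suc a) + f (Suc b)) * crossing_density f (x, y) (Suc a) (Suc b) =
      f (Suc a) * crossing_density f (x, y) a (Suc b) +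
      f (Suc b) * crossing_density f (x, y) (Suc a) b" .
qed

lemma crossing_density_pos:
  assumes "a \<ge> x" "b \<ge> y"
  shows "crossing_density f (x, y) a b > 0"
  using visit_prob_pos[OF assms] pos[of a] pos[of b] assms x1 y1
  by (simp add: crossing_density_def)

text \<open>The a priori bound for \<open>backward_harmonic_convergent\<close>:
  \<open>u * v / (u + v)\<close> is at most \<open>min u v\<close>.\<close>

lemma crossing_density_le:
  assumes "a \<ge> x" "b \<ge> y"
  shows "crossing_density f (x, y) a b \<le> min (f a) (f b)"
proof -
  have p: "f a > 0" "f b > 0" using pos assms x1 y1 by simp_all
  have "crossing_density f (x, y) a b \<le> f a * f b / (f a + f b) * 1"
    unfolding crossing_density_def using visit_prob_le_1 p by (intro mult_left_mono) auto
  also have "\<dots> \<le> min (f a) (f b)"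
    using p by (simp add: field_simps)
  finally show ?thesis .
qed

text \<open>Decompose according to the step after which both coordinates exceed \<open>n\<close> for the first time: it
  leads from \<open>(n, k)\<close> to \<open>(n + 1, k)\<close> or from \<open>(k, n)\<close> to \<open>(k, n + 1)\<close> for some \<open>k > n\<close>.\<close>

lemma both_exceed_sums:
  assumes n: "n \<ge> x" "n \<ge> y"
  shows "(\<lambda>i. (crossing_density f (x, y) n (Suc n + i) + crossing_density f (x, y) (Suc n + i) n)
       * (1 / f (Suc n + i))) sums measure (balls_bins f (x, y)) {\<omega>. both_exceed n \<omega>}"
proof -
  let ?N = "balls_bins f (x, y)"
  interpret prob_space ?N by (rule prob_space_balls_bins)
  define t where "t i = n + (Suc n + i) - x - y" for i
  define A where "A i = {\<omega>. \<omega> (t i) = (n, Suc n + i) \<and> \<omega> (Suc (t i)) = (Suc n, Suc n + i)}" for i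
  define B where "B i = {\<omega>. \<omega> (t i) = (Suc n + i, n) \<and> \<omega> (Suc (t i)) = (Suc n + i, Suc n)}" for i
  \<comment> \<open>The decomposition is disjoint and exhaustive on genuine paths only;
    \<open>drop_P\<close> removes the restriction afterwards.\<close>
  define P where "P = {\<omega>. bb_path (x, y) \<omega>}"
  have "{\<omega> \<in> space ?N. \<omega> m = s \<and> \<omega> (Suc m) = s'} \<in> events" for m s s' by measurable
  then have AB: "A i \<in> events" "B i \<in> events" for i by (simp_all add: A_def B_def)
  have "{\<omega> \<in> space ?N. bb_path (x, y) \<omega>} \<in> events" by measurable
  then have P: "P \<in> events" by (simp add: P_def)
  have "{\<omega> \<in> space ?N. both_exceed n \<omega>} \<in> events" by measurable
  then have E: "{\<omega>. both_exceed n \<omega>} \<in> events" by simp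
  have drop_P: "prob (C \<inter> P) = prob C" if "C \<in> events" for C
  proof (rule finite_measure_eq_AE)
    show "AE \<omega> in ?N. (\<omega> \<in> C \<inter> P) = (\<omega> \<in> C)"
      using AE_bb_path by eventually_elim (simp add: P_def)
  qed (use that P in auto)
  have disj: "disjoint_family (\<lambda>i. (A i \<union> B i) \<inter> P)"
  proof (unfold disjoint_family_on_def, intro ballI impI)
    fix i j :: nat
    \<comment> \<open>After the step at \<open>t i\<close> both coordinates exceed \<open>n\<close>
      for good, but at the later time \<open>t j\<close> one of them equals
      \<open>n\<close>.\<close>
    have *: False if "\<omega> \<in> (A i \<union> B i) \<inter> P" "\<omega> \<in> (A j \<union> B j) \<inter> P" "i < j" for \<omega> i j
    proof -
      have path: "bb_path (x, y) \<omega>" using that by (simp add: P_def)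
      have "Suc (t i) \<le> t j" using \<open>i < j\<close> n by (simp add: t_def)
      from bb_path_mono[OF path this] show False
        using that by (auto simp: A_def B_def)
    qed
    assume "i \<noteq> j"
    then show "((A i \<union> B i) \<inter> P) \<inter> ((A j \<union> B j) \<inter> P) = {}"
      using *[of _ i j] *[of _ j i] by (cases "i < j") auto
  qed
  have un: "(\<Union>i. (A i \<union> B i) \<inter> P) = {\<omega>. both_exceed n \<omega>} \<inter> P"
  proof (intro equalityI subsetI)
    fix \<omega> assume "\<omega> \<in> (\<Union>i. (A i \<union> B i) \<inter> P)"
    then obtain i where "\<omega> \<in> A i \<union> B i" "\<omega> \<in> P" by auto
    then show "\<omega> \<in> {\<omega>. both_exceed n \<omega>} \<inter> P"
      by (auto simp: A_def B_def both_exceed_def intro!: exI[of _ "Suc (t i)"])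
  next
    fix \<omega> assume \<omega>: "\<omega> \<in> {\<omega>. both_exceed n \<omega>} \<inter> P"
    then have path: "bb_path (x, y) \<omega>" by (simp add: P_def)
    define Q where "Q m \<longleftrightarrow> fst (\<omega> m) > n \<and> snd (\<omega> m) > n" for m
    have "\<exists>m. Q m" using \<omega> by (simp add: both_exceed_def Q_def)
    moreover have "\<not> Q 0" using path n by (simp add: Q_def bb_path_def)
    ultimately obtain m where m: "\<not> Q m" "Q (Suc m)"
      using ex_least_nat_less by (metis le_refl)
    have s: "fst (\<omega> m) + snd (\<omega> m) = x + y + m" using bb_path_sum[OF path] by simp
    show "\<omega> \<in> (\<Union>i. (A i \<union> B i) \<inter> P)"
      using bb_path_step[OF path, of m]
    proof
      assume st: "\<omega> (Suc m) = (Suc (fst (\<omega> m)), snd (\<omega> m))"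
      then have "fst (\<omega> m) = n" "snd (\<omega> m) \<ge> Suc n" using m by (auto simp: Q_def)
      moreover from this have "t (snd (\<omega> m) - Suc n) = m" using s by (simp add: t_def)
      ultimately have "\<omega> \<in> A (snd (\<omega> m) - Suc n)"
        using st by (simp add: A_def prod_eq_iff)
      then show ?thesis using \<omega> by blast
    next
      assume st: "\<omega> (Suc m) = (fst (\<omega> m), Suc (snd (\<omega> m)))"
      then have "snd (\<omega> m) = n" "fst (\<omega> m) \<ge> Suc n" using m by (auto simp: Q_def)
      moreover from this have "t (fst (\<omega> m) - Suc n) = m" using s by (simp add: t_def)
      ultimately have "\<omega> \<in> B (fst (\<omega> m) - Suc n)"
        using st by (simp add: B_def prod_eq_iff)
      then show ?thesis using \<omega> by blast
    qed
  qed
  have "(\<lambda>i. prob ((A i \<union> B i) \<inter> P)) sums prob (\<Union>i. (A i \<union> B i) \<inter> P)"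
    using AB P disj by (intro finite_measure_UNION) auto
  moreover have "prob ((A i \<union> B i) \<inter> P) =
      (crossing_density f (x, y) n (Suc n + i) + crossing_density f (x, y) (Suc n + i) n)
       * (1 / f (Suc n + i))" for i
  proof -
    define k where "k = Suc n + i"
    have k: "k \<ge> x" "k \<ge> y" "t i = n + k - x - y" "t i = k + n - x - y"
      using n by (simp_all add: k_def t_def)
    have p: "f n > 0" "f k > 0" using pos n k x1 by simp_all
    have "prob ((A i \<union> B i) \<inter> P) = prob (A i \<union> B i)"
      by (rule drop_P) (use AB in blast)
    also have "\<dots> = prob (A i) + prob (B i)"
    proof (rule finite_measure_Union[OF AB], rule equals0I)
      fix \<omega> assume "\<omega> \<in> A i \<inter> B i"
      then have "\<omega> \<in> A i" "\<omega> \<in> B i" by auto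
      have "fst (\<omega> (t i)) = n" using \<open>\<omega> \<in> A i\<close> by (simp add: A_def)
      moreover have "fst (\<omega> (t i)) = Suc n + i" using \<open>\<omega> \<in> B i\<close> by (simp add: B_def)
      ultimately show False by linarith
    qed
    also have "prob (A i) = visit_prob f (x, y) n k * (f n / (f n + f k))"
      unfolding A_def k_def[symmetric] by (rule measure_step_Bin1[OF n(1) k(2) k(3)])
    also have "prob (B i) = visit_prob f (x, y) k n * (f n / (f k + f n))"
      unfolding B_def k_def[symmetric] by (rule measure_step_Bin2[OF k(1) n(2) k(4)])
    \<comment> \<open>The step from level \<open>n\<close> contributes \<open>f n\<close>; dividing
      the density by \<open>f k\<close> leaves exactly this factor.\<close>
    also have "visit_prob f (x, y) n k * (f n / (f n + f k)) = crossing_density f (x, y) n k * (1 / f k)"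
      using p by (simp add: crossing_density_def)
    also have "visit_prob f (x, y) k n * (f n / (f k + f n)) = crossing_density f (x, y) k n * (1 / f k)"
      using p by (simp add: crossing_density_def)
    finally show ?thesis unfolding k_def[symmetric] distrib_right .
  qed
  ultimately show ?thesis unfolding un drop_P[OF E] by simp
qed

end

text \<open>The hypothesis makes the intersection of all these events null, so almost every
  trajectory has a level \<open>n0\<close> to which \<open>losing_number_gt_iff\<close>
  applies.\<close>

lemma measure_losing_number_gt:
  assumes lim: "(\<lambda>n. measure (balls_bins f u) {\<omega>. both_exceed n \<omega>}) \<longlonglongrightarrow> 0"
  shows "measure (balls_bins f u) {\<omega>. losing_number \<omega> > n} =
    measure (balls_bins f u) {\<omega>. both_exceed n \<omega>}"
proof -
  let ?N = "balls_bins f u"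
  interpret prob_space ?N by (rule prob_space_balls_bins)
  have "{\<omega> \<in> space ?N. both_exceed n \<omega>} \<in> events" for n by measurable
  then have E: "{\<omega>. both_exceed n \<omega>} \<in> events" for n by simp
  have "{\<omega> \<in> space ?N. \<forall>n. both_exceed n \<omega>} \<in> events" by measurable
  then have E': "{\<omega>. \<forall>n. both_exceed n \<omega>} \<in> events" by simp
  have "prob {\<omega>. \<forall>n. both_exceed n \<omega>} \<le> 0"
    using E by (intro LIMSEQ_le_const[OF lim] exI[of _ 0]) (auto intro!: finite_measure_mono)
  then have "prob {\<omega>. \<forall>n. both_exceed n \<omega>} = 0" by (simp add: measure_le_0_iff)
  then have "AE \<omega> in ?N. \<not> (\<forall>n. both_exceed n \<omega>)"
    using E' by (intro AE_I[of _ _ "{\<omega>. \<forall>n. both_exceed n \<omega>}"]) (auto simp: emeasure_eq_measure)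
  with AE_bb_path
  have ae: "AE \<omega> in ?N. (\<omega> \<in> {\<omega>. losing_number \<omega> > n}) = (\<omega> \<in> {\<omega>. both_exceed n \<omega>})"
    by eventually_elim (auto simp: losing_number_gt_iff)
  have "{\<omega> \<in> space ?N. losing_number \<omega> > n} \<in> events" by measurable
  then show ?thesis using E by (intro finite_measure_eq_AE[OF ae]) auto
qed

subsection \<open>Asymptotics of the losing number\<close>

theorem corollary2:
  fixes f :: "nat \<Rightarrow> real" and p :: real and x y :: nat
  assumes "p > 1"
    and "valid_feedback f"
    and "f \<sim>[at_top] (\<lambda>n. real n powr p)"
    and "x \<ge> 1" and "y \<ge> 1"
  shows "\<exists>c>0.
           (\<lambda>n. measure (balls_bins f (x, y)) {\<omega>. losing_number \<omega> > n})
             \<sim>[at_top] (\<lambda>n. c * (\<Sum>j. 1 / f (n + j))) \<and>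
           (\<lambda>n. measure (balls_bins f (x, y)) {\<omega>. losing_number \<omega> > n})
             \<sim>[at_top] (\<lambda>n. c / ((p - 1) * real n powr (p - 1)))"
proof -
  note valid = assms(2)[unfolded valid_feedback_def]
  have pos: "f n > 0" if "n \<ge> 1" for n
    using valid[THEN conjunct1] that by blast
  have mono: "mono_on {1..} f" by (rule valid[THEN conjunct2, THEN conjunct1])
  define T where "T n = (\<Sum>j. 1 / f (n + j))" for n
  define a where "a n = real n powr (1 - p) / (p - 1)" for n
  define P where "P n = measure (balls_bins f (x, y)) {\<omega>. both_exceed n \<omega>}" for n
  define K where "K = crossing_density f (x, y)"
  have sum: "summable (\<lambda>n. 1 / f n)" and Ta: "(\<lambda>n. T n / a n) \<longlonglongrightarrow> 1"
    using tail_sum_powr_asymp[OF \<open>p > 1\<close> assms(3)] by (simp_all add: T_def a_def)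
  have sumT: "summable (\<lambda>j. 1 / f (n + j))" for n
    using summable_iff_shift[of "\<lambda>n. 1 / f n" n] sum by (simp add: add.commute)
  have T_pos: "T n > 0" if "n \<ge> 1" for n
    unfolding T_def using sumT pos that by (intro suminf_pos) auto
  have T_Suc: "T (Suc n) = T n - 1 / f n" for n
    using suminf_split_head[OF sumT[of n]] by (simp add: T_def)
  have a_pos: "a n > 0" if "n \<ge> 1" for n using \<open>p > 1\<close> that by (simp add: a_def)
  have fp: "(\<lambda>n. f n / real n powr p) \<longlonglongrightarrow> 1"
    by (rule asymp_equivD_strong[OF assms(3)]) (auto simp: eventually_sequentially intro!: exI[of _ 1])
  \<comment> \<open>The product grows like \<open>n / (p - 1)\<close>. This feeds the diagonal bound
    and later shows that \<open>T (Suc n)\<close> and \<open>T n\<close> are asymptotic.\<close>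
  have fT: "filterlim (\<lambda>n. f n * T n) at_top sequentially"
  proof -
    have "(\<lambda>n. (f n / real n powr p) * (T n / a n)) \<longlonglongrightarrow> 1"
      using tendsto_mult[OF fp Ta] by simp
    moreover have "filterlim (\<lambda>n. real n powr p * a n) at_top sequentially"
      unfolding a_def using \<open>p > 1\<close> by real_asymp
    ultimately have "filterlim (\<lambda>n. (f n / real n powr p) * (T n / a n) * (real n powr p * a n))
        at_top sequentially"
      by (rule filterlim_tendsto_pos_mult_at_top[OF _ zero_less_one])
    moreover have "\<forall>\<^sub>F n in sequentially.
        (f n / real n powr p) * (T n / a n) * (real n powr p * a n) = f n * T n"
    proof (rule eventually_sequentiallyI)
      fix n :: nat assume "n \<ge> 1"
      then show "(f n / real n powr p) * (T n / a n) * (real n powr p * a n) = f n * T n"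
        using a_pos[of n] by simp
    qed
    ultimately show ?thesis by (rule filterlim_mono_eventually[OF _ order_refl order_refl])
  qed
  have K_har: "backward_harmonic f x y K"
    unfolding K_def using pos assms by (intro crossing_density_harmonic) auto
  have K_pos: "K a b > 0" if "a \<ge> x" "b \<ge> y" for a b
    unfolding K_def using pos assms that by (intro crossing_density_pos) auto
  have K_le: "\<bar>K a b\<bar> \<le> min (f a) (f b)" if "a \<ge> x" "b \<ge> y" for a b
  proof -
    have "K a b \<le> min (f a) (f b)"
      unfolding K_def using pos assms that by (intro crossing_density_le) auto
    then show ?thesis using K_pos[OF that] by simp
  qed
  obtain l where l: "\<And>e. e > 0 \<Longrightarrow> \<exists>N. \<forall>a\<ge>N. \<forall>b\<ge>N. \<bar>K a b - l\<bar> < e"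
    using backward_harmonic_convergent[OF pos K_har sum K_le] by blast
  obtain d N where d: "d > 0" "\<And>n. n \<ge> N \<Longrightarrow> K n n \<ge> d"
    using backward_harmonic_diagonal_bound[OF pos mono K_har K_pos sum fT[unfolded T_def]] by blast
  have "l > 0"
  proof -
    obtain N' where "\<bar>K a b - l\<bar> < d" if "a \<ge> N'" "b \<ge> N'" for a b using l[OF d(1)] by blast
    from this[of "max N N'" "max N N'"] d(2)[of "max N N'"] show ?thesis by simp
  qed
  \<comment> \<open>Each of the two crossing directions contributes a density that tends to
    \<open>l\<close>, uniformly in \<open>i\<close>.\<close>
  have "(\<lambda>n. P n / (\<Sum>i. 1 / f (Suc n + i))) \<longlonglongrightarrow> 2 * l"
  proof (rule weighted_average_tendsto)
    show "\<forall>\<^sub>F n in sequentially. summable (\<lambda>i. 1 / f (Suc n + i)) \<and> (\<forall>i. 1 / f (Suc n + i) > 0)"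
    proof (intro always_eventually allI conjI)
      show "summable (\<lambda>i. 1 / f (Suc n + i))" for n by (rule sumT)
      show "1 / f (Suc n + i) > 0" for n i using pos by simp
    qed
    show "\<forall>\<^sub>F n in sequentially. \<forall>i. \<bar>K n (Suc n + i) + K (Suc n + i) n - 2 * l\<bar> < e"
      if e: "e > 0" for e
    proof -
      obtain M where M: "\<bar>K a b - l\<bar> < e / 2" if "a \<ge> M" "b \<ge> M" for a b
        using l[of "e / 2"] e by auto
      show ?thesis
      proof (intro eventually_sequentiallyI allI)
        fix n i assume "n \<ge> M"
        then show "\<bar>K n (Suc n + i) + K (Suc n + i) n - 2 * l\<bar> < e"
          using M[of n "Suc n + i"] M[of "Suc n + i" n] by linarith
      qed
    qed
    show "\<forall>\<^sub>F n in sequentially.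
        (\<lambda>i. (K n (Suc n + i) + K (Suc n + i) n) * (1 / f (Suc n + i))) sums P n"
    proof (rule eventually_sequentiallyI)
      fix n assume "n \<ge> max x y"
      then show "(\<lambda>i. (K n (Suc n + i) + K (Suc n + i) n) * (1 / f (Suc n + i))) sums P n"
        unfolding P_def K_def by (intro both_exceed_sums) (use pos assms in auto)
    qed
  qed
  then have PT': "(\<lambda>n. P n / T (Suc n)) \<longlonglongrightarrow> 2 * l" by (simp add: T_def)
  \<comment> \<open>This is the ratio of \<open>T (Suc n)\<close> to \<open>T n\<close>; it moves
    the start of the tail from \<open>Suc n\<close> to \<open>n\<close>.\<close>
  have "(\<lambda>n. 1 - 1 / (f n * T n)) \<longlonglongrightarrow> 1 - 0"
    by (intro tendsto_diff tendsto_const real_tendsto_divide_at_top[OF tendsto_const fT])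
  from tendsto_mult[OF PT' this]
  have "(\<lambda>n. P n / T (Suc n) * (1 - 1 / (f n * T n))) \<longlonglongrightarrow> 2 * l" by simp
  moreover have "\<forall>\<^sub>F n in sequentially. P n / T (Suc n) * (1 - 1 / (f n * T n)) = P n / T n"
  proof (rule eventually_sequentiallyI)
    fix n :: nat assume "n \<ge> 1"
    then have "1 - 1 / (f n * T n) = T (Suc n) / T n"
      using T_pos[of n] pos[of n] by (simp add: T_Suc diff_divide_distrib)
    then show "P n / T (Suc n) * (1 - 1 / (f n * T n)) = P n / T n"
      using T_pos[of "Suc n"] by simp
  qed
  ultimately have PT: "(\<lambda>n. P n / T n) \<longlonglongrightarrow> 2 * l" by (rule Lim_transform_eventually)
  from tendsto_mult[OF this Ta]
  have "(\<lambda>n. P n / T n * (T n / a n)) \<longlonglongrightarrow> 2 * l" by simp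
  moreover have "\<forall>\<^sub>F n in sequentially. P n / T n * (T n / a n) = P n / a n"
  proof (rule eventually_sequentiallyI)
    fix n :: nat assume "n \<ge> 1"
    then show "P n / T n * (T n / a n) = P n / a n" using T_pos[of n] by simp
  qed
  ultimately have Pa: "(\<lambda>n. P n / a n) \<longlonglongrightarrow> 2 * l" by (rule Lim_transform_eventually)
  \<comment> \<open>Only now, with \<open>P\<close> shown to vanish in the limit, can
    \<open>P n\<close> be identified with the tail of the losing number.\<close>
  have "a \<longlonglongrightarrow> 0" unfolding a_def[abs_def] using \<open>p > 1\<close> by real_asymp
  from tendsto_mult[OF Pa this] have "(\<lambda>n. P n / a n * a n) \<longlonglongrightarrow> 0" by simp
  moreover have "\<forall>\<^sub>F n in sequentially. P n / a n * a n = P n"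
  proof (rule eventually_sequentiallyI)
    fix n :: nat assume "n \<ge> 1"
    then show "P n / a n * a n = P n" using a_pos[of n] by simp
  qed
  ultimately have "P \<longlonglongrightarrow> 0" by (rule Lim_transform_eventually)
  then have L: "measure (balls_bins f (x, y)) {\<omega>. losing_number \<omega> > n} = P n" for n
    unfolding P_def[abs_def] by (rule measure_losing_number_gt)
  have "P \<sim>[at_top] (\<lambda>n. 2 * l * T n)"
  proof (rule asymp_equivI')
    have "(\<lambda>n. P n / T n / (2 * l)) \<longlonglongrightarrow> 2 * l / (2 * l)"
      using \<open>l > 0\<close> by (intro tendsto_divide PT tendsto_const) auto
    then show "(\<lambda>n. P n / (2 * l * T n)) \<longlonglongrightarrow> 1" using \<open>l > 0\<close> by (simp add: mult.commute)
  qed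
  moreover have "P \<sim>[at_top] (\<lambda>n. 2 * l / ((p - 1) * real n powr (p - 1)))"
  proof (rule asymp_equivI')
    have "(\<lambda>n. P n / a n / (2 * l)) \<longlonglongrightarrow> 2 * l / (2 * l)"
      using \<open>l > 0\<close> by (intro tendsto_divide Pa tendsto_const) auto
    then have "(\<lambda>n. P n / (2 * l * a n)) \<longlonglongrightarrow> 1" using \<open>l > 0\<close> by (simp add: mult.commute)
    moreover have "2 * l * a n = 2 * l / ((p - 1) * real n powr (p - 1))" for n
    proof -
      have "1 - p = - (p - 1)" by simp
      show ?thesis unfolding a_def \<open>1 - p = - (p - 1)\<close> powr_minus_divide by simp
    qed
    ultimately show "(\<lambda>n. P n / (2 * l / ((p - 1) * real n powr (p - 1)))) \<longlonglongrightarrow> 1" by (simp only:)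
  qed
  ultimately show ?thesis
    using \<open>l > 0\<close> unfolding L T_def by (intro exI[of _ "2 * l"] conjI) simp_all
qed

end
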